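(* Let $m\ge n$ be positive integers. The assignment $$\Theta:\mathrm{Open}(\mathrm{maxSpec}(\mathcal{T}_{n,m}))\to\mathrm{Open}(\mathrm{maxSpec}(\mathbb{K}[X])),\qquad U\mapsto\{N_{\underline\alpha}\in\mathrm{maxSpec}(\mathbb{K}[X])\mid\exists\,M_{\underline t}\in U\text{ with }\Psi(\underline\alpha)=\underline t\}$$ is well defined (i.e. the image of each open set is open). Moreover, for every $f\in\mathcal{T}_{n,m}$, $\Theta(D(f))=\Xi(D(f))$, that is, $\Theta$ restricts to $\Xi$ on basic open sets.
   Context: Let $\mathbb{K}$ be an algebraically closed field of characteristic zero. A semistandard Young tableau of partition shape $\lambda$ is a filling of the Ferrers diagram of $\lambda$ (English notation) with positive integers, strictly increasing down columns and weakly increasing from left to right along rows. For positive integers $m\ge n$, $\mathrm{SSYT}_m^n$ denotes the set of all semistandard Young tableaux of all partition shapes with at most $n$ rows and with entries in $\{1,\dots,m\}$ (including the empty tableau $\emptyset$). For $T$ of shape $\lambda$ and $T'$ of shape $\mu$, $T\star T'$ is the semistandard Young tableau of shape $\lambda+\mu$ obtained by horizontally concatenating the rows of $T$ and $T'$ and sorting the entries in each row in weakly increasing order. $(\mathrm{SSYT}_m^n,\star,\emptyset)$ is a commutative monoid, and the tableaux algebra $\mathcal{T}_{n,m}$ is its monoid algebra over $\mathbb{K}$. Let $G_{n,m}=\{T_1,\dots,T_d\}$ be the set of tableaux in $\mathrm{SSYT}_m^n$ with exactly one column; it generates $\mathcal{T}_{n,m}$. Every maximal ideal of $\mathcal{T}_{n,m}$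 is of the form $M_{\underline t}=\langle T_1-t_1,\dots,T_d-t_d\rangle$ for a unique $\underline t\in\mathbb{K}^d$ satisfying $t_at_b=t_ct_e$ whenever $T_a\star T_b=T_c\star T_e$, and each such $\underline t$ gives a maximal ideal. Let $X=\{x^{(i)}_j:1\le i\le n,1\le j\le m\}$ be commuting variables. The maximal ideals of $\mathbb{K}[X]$ are $N_{\underline\alpha}=\langle x_j^{(i)}-\alpha_{i,j}\rangle_{i,j}$ for $\underline\alpha=(\alpha_{i,j})\in\mathbb{K}^{nm}$. Define $\Psi:\mathbb{K}^{nm}\to\mathbb{K}^d$ by $\Psi(\underline\alpha)=(\widetilde{\mathrm{ev}}_{\underline\alpha}(T_1),\dots,\widetilde{\mathrm{ev}}_{\underline\alpha}(T_d))$, where $\widetilde{\mathrm{ev}}_{\underline\alpha}(T)=\prod_{i,j}\alpha_{i,j}^{\mathrm{wt}_j^{(i)}(T)}$ and $\mathrm{wt}_j^{(i)}(T)$ is the number of $j$'s in row $i$ of $T$. For a commutative ring $A$, $\mathrm{maxSpec}(A)$ carries the Zariski topology with basis $\Delta(\mathrm{maxSpec}(A))=\{D(f):f\in A\}$, $D(f)=\{M\in\mathrm{maxSpec}(A):f\notin M\}$; $\mathrm{Open}(\cdot)$ is the set of open subsets. $\Xi:\Delta(\mathrm{maxSpec}(\mathcal{T}_{n,m}))\to\Delta(\mathrm{maxSpec}(\mathbb{K}[X]))$ is the map $D(f)\mapsto\{N_{\underline\alpha}\mid\exists M_{\underline t}\in D(f)\text{ with }\Psi(\underline\alpha)=\underline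 t\}$, which is well defined and satisfies $\Xi(D(f))=D(\Omega(f))$, where $\Omega:\mathcal{T}_{n,m}\to\mathbb{K}[X]$ is the algebra morphism given on tableaux by $T\mapsto\prod_{i,j}(x_j^{(i)})^{\mathrm{wt}_j^{(i)}(T)}$. *)

theory Defs
  imports
    "HOL-Library.Poly_Mapping"
    "HOL-Library.Multiset"
    "HOL-Library.FuncSet"
    "HOL-Algebra.Ideal"
    "HOL-Analysis.Function_Topology"
    "HOL-Computational_Algebra.Polynomial"
begin

section \<open>Semistandard Young tableaux\<close>

text \<open>
  A filling is the list of its rows, from top to bottom. List positions start at 0;
  rows below the last one are empty.
\<close>

definition row :: "nat list list \<Rightarrow> nat \<Rightarrow> nat list" where
  "row R i = (if i < length R then R ! i else [])"

definition semistandard :: "nat list list \<Rightarrow> bool" where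
  "semistandard R \<longleftrightarrow>
     (\<forall>r\<in>set R. r \<noteq> [] \<and> sorted r \<and> (\<forall>x\<in>set r. 0 < x)) \<and>
     (\<forall>i. Suc i < length R \<longrightarrow>
        length (R ! Suc i) \<le> length (R ! i) \<and>
        (\<forall>j < length (R ! Suc i). R ! i ! j < R ! Suc i ! j))"

definition star_rows :: "nat list list \<Rightarrow> nat list list \<Rightarrow> nat list list" where
  "star_rows R S = map (\<lambda>i. sort (row R i @ row S i)) [0..<max (length R) (length S)]"

lemma length_star_rows [simp]: "length (star_rows R S) = max (length R) (length S)"
  by (simp add: star_rows_def)

lemma row_star_rows: "row (star_rows R S) i = sort (row R i @ row S i)"
  by (auto simp: star_rows_def row_def)

lemma rows_eqI:
  assumes "length R = length S" and "\<And>i. row R i = row S i"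
  shows "R = S"
proof (rule nth_equalityI[OF assms(1)])
  fix i assume "i < length R"
  with assms(1) assms(2)[of i] show "R ! i = S ! i" by (simp add: row_def)
qed

definition column_strict :: "nat list \<Rightarrow> nat list \<Rightarrow> bool" where
  "column_strict a b \<longleftrightarrow> length b \<le> length a \<and> (\<forall>j < length b. a ! j < b ! j)"

lemma sorted_nth_le_iff:
  fixes a :: "nat list"
  assumes "sorted a" and "\<And>x y. x \<le> y \<Longrightarrow> P y \<Longrightarrow> P x" and "j < length a"
  shows "P (a ! j) \<longleftrightarrow> j < length (filter P a)"
  using assms(1,3)
proof (induction a arbitrary: j)
  case Nil
  then show ?case by simp
next
  case (Cons x xs)
  show ?case
  proof (cases "P x")
    case True
    with Cons show ?thesis by (cases j) auto
  next
    case False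
    with Cons.prems assms(2) have "\<not> P y" if "y \<in> set (x # xs)" for y
      using that by auto
    then have "filter P (x # xs) = []" and "\<not> P ((x # xs) ! j)"
      using Cons.prems(2) nth_mem by (auto simp only: filter_empty_conv)
    then show ?thesis by simp
  qed
qed

lemma column_strict_iff:
  assumes "sorted a" and "sorted b"
  shows "column_strict a b \<longleftrightarrow>
    (\<forall>v. length (filter (\<lambda>x. x \<le> v) b) \<le> length (filter (\<lambda>x. x < v) a))"
    (is "_ \<longleftrightarrow> ?R")
proof
  assume ab: "column_strict a b"
  show ?R
  proof
    fix v
    show "length (filter (\<lambda>x. x \<le> v) b) \<le> length (filter (\<lambda>x. x < v) a)"
    proof (cases "length (filter (\<lambda>x. x \<le> v) b)")
      case (Suc k)
      have kb: "k < length b"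
        using Suc length_filter_le[of "\<lambda>x. x \<le> v" b] by linarith
      then have "b ! k \<le> v"
        using sorted_nth_le_iff[OF assms(2), of "\<lambda>x. x \<le> v" k] Suc by auto
      moreover have "a ! k < b ! k" and ka: "k < length a"
        using ab kb by (auto simp: column_strict_def)
      ultimately have "a ! k < v" by linarith
      then show ?thesis
        using sorted_nth_le_iff[OF assms(1), of "\<lambda>x. x < v" k] ka Suc by auto
    qed simp
  qed
next
  assume R: ?R
  have "length b \<le> length a"
  proof -
    have "filter (\<lambda>x. x \<le> sum_list b) b = b"
      by (rule filter_True) (simp add: member_le_sum_list)
    then have "length b = length (filter (\<lambda>x. x \<le> sum_list b) b)"
      by simp
    also have "\<dots> \<le> length (filter (\<lambda>x. x < sum_list b) a)" using R by blast
    also have "\<dots> \<le> length a" by simp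
    finally show ?thesis .
  qed
  moreover have "a ! j < b ! j" if "j < length b" for j
  proof -
    have "j < length (filter (\<lambda>x. x \<le> b ! j) b)"
      using sorted_nth_le_iff[OF assms(2), of "\<lambda>x. x \<le> b ! j" j] that by auto
    also have "\<dots> \<le> length (filter (\<lambda>x. x < b ! j) a)" using R by blast
    finally show ?thesis
      using sorted_nth_le_iff[OF assms(1), of "\<lambda>x. x < b ! j" j]
        that \<open>length b \<le> length a\<close> by auto
  qed
  ultimately show "column_strict a b" by (simp add: column_strict_def)
qed

lemma length_filter_sort: "length (filter P (sort xs)) = length (filter P xs)"
  by (metis mset_filter mset_sort size_mset)

lemma column_strict_sort_append:
  assumes "sorted a" "sorted b" "sorted c" "sorted d"
    and "column_strict a b" "column_strict c d"
  shows "column_strict (sort (a @ c)) (sort (b @ d))"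
  using assms(5,6)
  unfolding column_strict_iff[OF assms(1,2)] column_strict_iff[OF assms(3,4)]
    column_strict_iff[OF sorted_sort sorted_sort] length_filter_sort
  by (simp add: add_mono)

lemma semistandard_iff_row:
  "semistandard R \<longleftrightarrow>
     (\<forall>i. (i < length R \<longrightarrow> row R i \<noteq> []) \<and> sorted (row R i) \<and> (\<forall>x\<in>set (row R i). 0 < x) \<and>
          column_strict (row R i) (row R (Suc i)))"
proof
  assume R: "semistandard R"
  show "\<forall>i. (i < length R \<longrightarrow> row R i \<noteq> []) \<and> sorted (row R i) \<and>
      (\<forall>x\<in>set (row R i). 0 < x) \<and> column_strict (row R i) (row R (Suc i))"
  proof
    fix i
    consider "Suc i < length R" | "i < length R" "length R \<le> Suc i" | "length R \<le> i"
      by linarith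
    then show "(i < length R \<longrightarrow> row R i \<noteq> []) \<and> sorted (row R i) \<and>
      (\<forall>x\<in>set (row R i). 0 < x) \<and> column_strict (row R i) (row R (Suc i))"
    proof cases
      case 1
      then have "R ! i \<in> set R" by simp
      with R have "R ! i \<noteq> [] \<and> sorted (R ! i) \<and> (\<forall>x\<in>set (R ! i). 0 < x)"
        unfolding semistandard_def by blast
      moreover have "column_strict (R ! i) (R ! Suc i)"
        using R 1 unfolding semistandard_def column_strict_def by blast
      ultimately show ?thesis using 1 by (simp add: row_def)
    next
      case 2
      then have "R ! i \<in> set R" by simp
      with R have "R ! i \<noteq> [] \<and> sorted (R ! i) \<and> (\<forall>x\<in>set (R ! i). 0 < x)"
        unfolding semistandard_def by blast
      with 2 show ?thesis by (simp add: row_def column_strict_def)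
    next
      case 3
      then show ?thesis by (simp add: row_def column_strict_def)
    qed
  qed
next
  assume *: "\<forall>i. (i < length R \<longrightarrow> row R i \<noteq> []) \<and> sorted (row R i) \<and>
      (\<forall>x\<in>set (row R i). 0 < x) \<and> column_strict (row R i) (row R (Suc i))"
  have "r \<noteq> [] \<and> sorted r \<and> (\<forall>x\<in>set r. 0 < x)" if "r \<in> set R" for r
  proof -
    from \<open>r \<in> set R\<close> obtain i where "i < length R" "R ! i = r"
      unfolding in_set_conv_nth by blast
    then show ?thesis using *[rule_format, of i] by (simp add: row_def)
  qed
  moreover have "column_strict (R ! i) (R ! Suc i)" if "Suc i < length R" for i
    using *[rule_format, of i] that by (simp add: row_def)
  ultimately show "semistandard R"
    unfolding semistandard_def column_strict_def by blast
qed

lemma semistandard_star_rows: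
  assumes "semistandard R" and "semistandard S"
  shows "semistandard (star_rows R S)"
  unfolding semistandard_iff_row
proof (intro allI conjI impI)
  note R = assms(1)[unfolded semistandard_iff_row, rule_format]
  note S = assms(2)[unfolded semistandard_iff_row, rule_format]
  fix i
  show "row (star_rows R S) i \<noteq> []" if "i < length (star_rows R S)"
  proof -
    have "0 < length (row R i) \<or> 0 < length (row S i)"
      using that R[of i] S[of i] by (simp add: less_max_iff_disj) blast
    then have "0 < length (row (star_rows R S) i)"
      by (simp add: row_star_rows)
    then show ?thesis by simp
  qed
  show "sorted (row (star_rows R S) i)"
    by (simp add: row_star_rows)
  show "\<forall>x\<in>set (row (star_rows R S) i). 0 < x"
    using R[of i] S[of i] by (auto simp: row_star_rows)
  show "column_strict (row (star_rows R S) i) (row (star_rows R S) (Suc i))"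
    unfolding row_star_rows
    using R[of i] S[of i] R[of "Suc i"] S[of "Suc i"]
    by (intro column_strict_sort_append) auto
qed

typedef ssyt = "{R. semistandard R}"
  morphisms rows Abs_ssyt
  by (rule exI[of _ "[]"]) (simp add: semistandard_def)

setup_lifting type_definition_ssyt

text \<open>
  The addition of tableaux is the operation \<open>\<star>\<close>, so that the type
  \<open>ssyt \<Rightarrow>\<^sub>0 'k\<close>, with its convolution product, is the monoid
  algebra of the monoid of all tableaux.
\<close>

instantiation ssyt :: comm_monoid_add
begin

lift_definition zero_ssyt :: ssyt is "[]"
  by (simp add: semistandard_def)

lift_definition plus_ssyt :: "ssyt \<Rightarrow> ssyt \<Rightarrow> ssyt" is star_rows
  by (rule semistandard_star_rows)

instance
proof
  fix S T U :: ssyt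
  show "S + T + U = S + (T + U)"
  proof (transfer, rule rows_eqI)
    fix S T U :: "nat list list" and i
    show "length (star_rows (star_rows S T) U) = length (star_rows S (star_rows T U))"
      by simp
    show "row (star_rows (star_rows S T) U) i = row (star_rows S (star_rows T U)) i"
      unfolding row_star_rows by (rule properties_for_sort) simp_all
  qed
  show "S + T = T + S"
  proof (transfer, rule rows_eqI)
    fix S T :: "nat list list" and i
    show "length (star_rows S T) = length (star_rows T S)"
      by simp
    show "row (star_rows S T) i = row (star_rows T S) i"
      unfolding row_star_rows by (rule properties_for_sort) simp_all
  qed
  show "0 + T = T"
  proof (transfer, rule rows_eqI)
    fix T :: "nat list list" and i
    assume "semistandard T"
    then show "row (star_rows [] T) i = row T i"
      by (simp add: row_star_rows semistandard_iff_row sorted_sort_id row_def[of "[]"])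
  qed simp
qed

end

definition SSYT :: "nat \<Rightarrow> nat \<Rightarrow> ssyt set" where
  "SSYT m n = {T. length (rows T) \<le> n \<and> (\<forall>r\<in>set (rows T). set r \<subseteq> {1..m})}"

definition one_column :: "nat \<Rightarrow> nat \<Rightarrow> ssyt set" where
  "one_column n m = {T \<in> SSYT m n. length (row (rows T) 0) = 1}"

text \<open>The number of \<open>j\<close>'s in row \<open>i\<close>, with rows counted from 1.\<close>

definition wt :: "ssyt \<Rightarrow> nat \<Rightarrow> nat \<Rightarrow> nat" where
  "wt T i j = count_list (row (rows T) (i - 1)) j"

section \<open>The two algebras\<close>

definition ring_on :: "'r::comm_ring_1 set \<Rightarrow> 'r ring" where
  "ring_on A = \<lparr>carrier = A, monoid.mult = (*), one = 1, zero = 0, add = (+)\<rparr>"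

definition tableaux_algebra :: "nat \<Rightarrow> nat \<Rightarrow> (ssyt \<Rightarrow>\<^sub>0 'k::field) ring" where
  "tableaux_algebra n m = ring_on {f. Poly_Mapping.keys f \<subseteq> SSYT m n}"

text \<open>
  Monomials are finitely supported exponent vectors; the variable \<open>(i, j)\<close> is the
  one with row index \<open>i \<le> n\<close> and entry index \<open>j \<le> m\<close>.
\<close>

definition polynomial_algebra :: "nat \<Rightarrow> nat \<Rightarrow> ((nat \<times> nat \<Rightarrow>\<^sub>0 nat) \<Rightarrow>\<^sub>0 'k::field) ring" where
  "polynomial_algebra n m =
     ring_on {p. \<forall>\<mu>\<in>Poly_Mapping.keys p. Poly_Mapping.keys \<mu> \<subseteq> {1..n} \<times> {1..m}}"

section \<open>Maximal spectra\<close>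

definition max_spec :: "('r, 'x) ring_scheme \<Rightarrow> 'r set set" where
  "max_spec A = {M. maximalideal M A}"

definition basic_open :: "('r, 'x) ring_scheme \<Rightarrow> 'r \<Rightarrow> 'r set set" where
  "basic_open A f = {M \<in> max_spec A. f \<notin> M}"

definition basic_opens :: "('r, 'x) ring_scheme \<Rightarrow> 'r set set set" where
  "basic_opens A = basic_open A ` carrier A"

text \<open>
  Since \<open>D(f) \<inter> D(g) = D(f g)\<close> and \<open>D(1)\<close> is the whole
  spectrum, the sets \<open>D(f)\<close> are a basis of the topology that they generate.
\<close>

definition zariski :: "('r, 'x) ring_scheme \<Rightarrow> 'r set topology" where
  "zariski A = topology_generated_by (basic_opens A)"

definition opens :: "('r, 'x) ring_scheme \<Rightarrow> 'r set set set" where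
  "opens A = {U. openin (zariski A) U}"

text \<open>
  The points of \<open>\<K>\<^sup>d\<close> are functions on the set of the \<open>d\<close>
  one-column tableaux, instead of being indexed by an enumeration of it.
\<close>

definition tableaux_points :: "nat \<Rightarrow> nat \<Rightarrow> (ssyt \<Rightarrow> 'k::field) set" where
  "tableaux_points n m =
     {t \<in> one_column n m \<rightarrow>\<^sub>E UNIV.
        \<forall>A\<in>one_column n m. \<forall>B\<in>one_column n m. \<forall>C\<in>one_column n m. \<forall>E\<in>one_column n m.
          A + B = C + E \<longrightarrow> t A * t B = t C * t E}"

definition tableaux_ideal :: "nat \<Rightarrow> nat \<Rightarrow> (ssyt \<Rightarrow> 'k::field) \<Rightarrow> (ssyt \<Rightarrow>\<^sub>0 'k) set" where
  "tableaux_ideal n m t =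
     Idl\<^bsub>tableaux_algebra n m\<^esub>
       {Poly_Mapping.single T 1 - Poly_Mapping.single 0 (t T) | T. T \<in> one_column n m}"

definition polynomial_points :: "nat \<Rightarrow> nat \<Rightarrow> (nat \<times> nat \<Rightarrow> 'k::field) set" where
  "polynomial_points n m = {1..n} \<times> {1..m} \<rightarrow>\<^sub>E UNIV"

definition polynomial_ideal ::
    "nat \<Rightarrow> nat \<Rightarrow> (nat \<times> nat \<Rightarrow> 'k::field) \<Rightarrow> ((nat \<times> nat \<Rightarrow>\<^sub>0 nat) \<Rightarrow>\<^sub>0 'k) set" where
  "polynomial_ideal n m \<alpha> =
     Idl\<^bsub>polynomial_algebra n m\<^esub>
       {Poly_Mapping.single (Poly_Mapping.single (i, j) 1) 1 - Poly_Mapping.single 0 (\<alpha> (i, j)) |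
        i j. i \<in> {1..n} \<and> j \<in> {1..m}}"

definition ev :: "nat \<Rightarrow> nat \<Rightarrow> (nat \<times> nat \<Rightarrow> 'k::field) \<Rightarrow> ssyt \<Rightarrow> 'k" where
  "ev n m \<alpha> T = (\<Prod>i\<in>{1..n}. \<Prod>j\<in>{1..m}. \<alpha> (i, j) ^ wt T i j)"

definition Psi :: "nat \<Rightarrow> nat \<Rightarrow> (nat \<times> nat \<Rightarrow> 'k::field) \<Rightarrow> (ssyt \<Rightarrow> 'k)" where
  "Psi n m \<alpha> = (\<lambda>T\<in>one_column n m. ev n m \<alpha> T)"

definition Xi ::
    "nat \<Rightarrow> nat \<Rightarrow> (ssyt \<Rightarrow>\<^sub>0 'k::field) set set \<Rightarrow> ((nat \<times> nat \<Rightarrow>\<^sub>0 nat) \<Rightarrow>\<^sub>0 'k) set set" where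
  "Xi n m =
     (\<lambda>D\<in>basic_opens (tableaux_algebra n m).
        {polynomial_ideal n m \<alpha> | \<alpha>. \<alpha> \<in> polynomial_points n m \<and>
           (\<exists>t\<in>tableaux_points n m. tableaux_ideal n m t \<in> D \<and> Psi n m \<alpha> = t)})"

definition Theta ::
    "nat \<Rightarrow> nat \<Rightarrow> (ssyt \<Rightarrow>\<^sub>0 'k::field) set set \<Rightarrow> ((nat \<times> nat \<Rightarrow>\<^sub>0 nat) \<Rightarrow>\<^sub>0 'k) set set" where
  "Theta n m =
     (\<lambda>U\<in>opens (tableaux_algebra n m).
        {N \<in> max_spec (polynomial_algebra n m).
           \<exists>\<alpha>\<in>polynomial_points n m. N = polynomial_ideal n m \<alpha> \<and>
             (\<exists>t\<in>tableaux_points n m. tableaux_ideal n m t \<in> U \<and> Psi n m \<alpha> = t)})"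

end

theory Submission
  imports Defs
begin

text \<open>
  Write \<open>\<K>\<close> for the ground field and \<open>M\<^sub>t\<close>, \<open>N\<^sub>\<alpha>\<close> for the ideals
  \<open>tableaux_ideal n m t\<close> and \<open>polynomial_ideal n m \<alpha>\<close>. On maximal ideals, \<open>\<Theta>\<close> takes
  preimages under the map \<open>N\<^sub>\<alpha> \<mapsto> M\<^bsub>\<Psi>(\<alpha>)\<^esub>\<close>, so the first claim of the theorem says
  that this map is continuous; and \<open>\<Xi>\<close> is given by the same formula, once all \<open>N\<^sub>\<alpha>\<close> are
  known to be maximal. Continuity can be tested on basic open sets, and there it comes from
  the algebra morphism \<open>\<Omega>\<close>: both ideals are kernels of evaluations, \<open>N\<^sub>\<alpha>\<close> of
  \<open>p \<mapsto> p(\<alpha>)\<close> and \<open>M\<^bsub>\<Psi>(\<alpha>)\<^esub>\<close> of the linear extension of the weight evaluation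
  \<open>ev n m \<alpha>\<close>, and the second evaluation is the first one after \<open>\<Omega>\<close>. Hence
  \<open>f \<in> M\<^bsub>\<Psi>(\<alpha>)\<^esub>\<close> holds exactly if \<open>\<Omega> f \<in> N\<^sub>\<alpha>\<close>, so that the preimage of \<open>D(f)\<close> is
  \<open>D(\<Omega> f)\<close> (\<open>preimage_spec_basic_open\<close>).

  Three facts carry this argument. First, for an algebra of a monoid generated by \<open>G\<close>, the
  kernel of the evaluation at a character \<open>\<chi>\<close> is generated by the elements \<open>g - \<chi> g\<close> with
  \<open>g \<in> G\<close> (\<open>genideal_eq_kernel\<close>); this one lemma describes both families of ideals.
  Secondly, the monoid of tableaux is generated by the tableaux with one column, because
  the first column of a tableau can be split off (\<open>SSYT_eq_span_one_column\<close>).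
  Thirdly, every maximal ideal of the polynomial algebra is some \<open>N\<^sub>\<alpha>\<close>
  (\<open>max_spec_polynomial_algebra\<close>), for otherwise \<open>D(\<Omega> f)\<close> could contain points outside of
  the image of \<open>\<Theta>\<close>. This is Hilbert's Nullstellensatz.

  The Nullstellensatz is proved in the form: for a prime ideal \<open>P\<close> and \<open>b \<notin> P\<close> there is a
  common zero of \<open>P\<close> at which \<open>b\<close> does not vanish (\<open>nullstellensatz_avoiding\<close>). The
  coordinates of the zero are chosen one after the other. The induction step
  (\<open>extension_step\<close>) says that a homomorphism to \<open>\<K>\<close> on a subring \<open>S\<close> extends to
  \<open>S[x]\<close> modulo \<open>P\<close> without killing \<open>b \<in> S[x]\<close>, as long as it does not kill a certain
  \<open>r \<in> S\<close> outside of \<open>P\<close>. As \<open>b\<close> is arbitrary, the condition on \<open>r\<close> can be met by the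
  choice of the earlier coordinates.
\<close>

section \<open>Polynomials over a subring\<close>

locale subring_set =
  fixes S :: "'r::comm_ring_1 set"
  assumes one_closed: "1 \<in> S"
    and diff_closed: "a \<in> S \<Longrightarrow> b \<in> S \<Longrightarrow> a - b \<in> S"
    and mult_closed: "a \<in> S \<Longrightarrow> b \<in> S \<Longrightarrow> a * b \<in> S"
begin

lemma zero_closed: "0 \<in> S"
  using diff_closed[OF one_closed one_closed] by simp

lemma uminus_closed: "a \<in> S \<Longrightarrow> - a \<in> S"
  using diff_closed[OF zero_closed, of a] by simp

lemma add_closed: "a \<in> S \<Longrightarrow> b \<in> S \<Longrightarrow> a + b \<in> S"
  using diff_closed[OF _ uminus_closed, of a b] by simp

lemma power_closed: "a \<in> S \<Longrightarrow> a ^ k \<in> S"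
  by (induction k) (simp_all add: one_closed mult_closed)

lemma sum_closed: "(\<And>i. i \<in> I \<Longrightarrow> f i \<in> S) \<Longrightarrow> sum f I \<in> S"
  by (induction I rule: infinite_finite_induct) (simp_all add: zero_closed add_closed)

end

definition polys_over :: "'r::zero set \<Rightarrow> 'r poly set" where
  "polys_over S = {p. \<forall>i. coeff p i \<in> S}"

lemma polys_overD: "p \<in> polys_over S \<Longrightarrow> coeff p i \<in> S"
  by (simp add: polys_over_def)

lemma (in subring_set) subring_polys_over: "subring_set (polys_over S)"
  by standard (auto simp: polys_over_def coeff_mult coeff_1 zero_closed one_closed
      intro!: diff_closed sum_closed mult_closed)

lemma (in subring_set) monom_polys_over: "c \<in> S \<Longrightarrow> monom c k \<in> polys_over S"
  by (auto simp: polys_over_def zero_closed)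

lemma (in subring_set) smult_polys_over:
  "c \<in> S \<Longrightarrow> p \<in> polys_over S \<Longrightarrow> smult c p \<in> polys_over S"
  by (auto simp: polys_over_def intro: mult_closed)

lemma (in subring_set) poly_closed:
  assumes "p \<in> polys_over S" and "x \<in> S"
  shows "poly p x \<in> S"
  unfolding poly_altdef
  by (intro sum_closed mult_closed power_closed assms polys_overD)

lemma polys_over_mono: "S \<subseteq> B \<Longrightarrow> polys_over S \<subseteq> polys_over B"
  by (auto simp: polys_over_def)

text \<open>
  Division with remainder when the leading coefficient of the divisor is not a unit: each
  step multiplies the dividend by that coefficient. The bound on the coefficients of the
  quotient says that its degree is the expected one; it is stated with an upper bound
  \<open>N\<close> instead of a degree so that \<open>0\<close> needs no separate treatment.
\<close>

lemma (in subring_set) pseudo_division: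
  assumes f: "f \<in> polys_over S" and g: "g \<in> polys_over S"
    and "\<And>i. N \<le> i \<Longrightarrow> coeff g i = 0"
  shows "\<exists>k. \<exists>q \<in> polys_over S. \<exists>r \<in> polys_over S.
           smult (lead_coeff f ^ k) g = q * f + r \<and>
           (\<forall>i\<ge>degree f. coeff r i = 0) \<and> (\<forall>i. N \<le> i + degree f \<longrightarrow> coeff q i = 0)"
  using g assms(3)
proof (induction N arbitrary: g)
  case 0
  then have "g = 0" by (intro poly_eqI) simp
  then show ?case
    using zero_closed by (intro exI[of _ 0] bexI[of _ 0]) (auto simp: polys_over_def)
next
  case (Suc N)
  interpret P: subring_set "polys_over S" by (rule subring_polys_over)
  show ?case
  proof (cases "N < degree f")
    case True
    with Suc.prems show ?thesis
      by (intro exI[of _ 0] bexI[of _ 0] bexI[of _ g]) (auto simp: P.zero_closed)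
  next
    case False
    \<comment> \<open>\<open>t\<close> times the divisor cancels the coefficient of \<open>c g\<close> with index \<open>N\<close>.\<close>
    define c where "c = lead_coeff f"
    define t where "t = monom (coeff g N) (N - degree f)"
    have cS: "c \<in> S" using f by (simp add: c_def polys_overD)
    have tS: "t \<in> polys_over S"
      unfolding t_def by (intro monom_polys_over polys_overD Suc.prems)
    have "smult c g - t * f \<in> polys_over S"
      by (intro P.diff_closed P.mult_closed smult_polys_over cS tS f Suc.prems)
    moreover have "coeff (smult c g - t * f) i = 0" if "N \<le> i" for i
    proof (cases "i = N")
      case True
      with False show ?thesis by (simp add: t_def c_def coeff_monom_mult)
    next
      case ne: False
      with that have "coeff f (i - (N - degree f)) = 0"
        using False by (intro coeff_eq_0) linarith
      moreover have "coeff g i = 0" using ne that by (intro Suc.prems) simp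
      ultimately show ?thesis by (simp add: t_def coeff_monom_mult)
    qed
    ultimately obtain k q r where q: "q \<in> polys_over S" and r: "r \<in> polys_over S"
      and eq: "smult (c ^ k) (smult c g - t * f) = q * f + r"
      and r0: "\<forall>i\<ge>degree f. coeff r i = 0" and q0: "\<forall>i. N \<le> i + degree f \<longrightarrow> coeff q i = 0"
      using Suc.IH[of "smult c g - t * f"] unfolding c_def by metis
    show ?thesis
    proof (rule exI[of _ "Suc k"], rule bexI[of _ "q + smult (c ^ k) t"], rule bexI[of _ r], intro conjI)
      show "smult (lead_coeff f ^ Suc k) g = (q + smult (c ^ k) t) * f + r"
        using eq by (simp add: c_def algebra_simps smult_diff_right)
      show "\<forall>i. Suc N \<le> i + degree f \<longrightarrow> coeff (q + smult (c ^ k) t) i = 0"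
        using q0 False by (auto simp: t_def)
      show "q + smult (c ^ k) t \<in> polys_over S"
        by (intro P.add_closed q smult_polys_over power_closed cS tS)
    qed (use r r0 in auto)
  qed
qed

section \<open>Extending a homomorphism by one element\<close>

text \<open>
  Prime ideals of a subring of an ambient ring type, stated with the operations of that
  type, so that one ideal can be intersected with a chain of smaller subrings.
\<close>

definition prime_in :: "'r::comm_ring_1 set \<Rightarrow> 'r set \<Rightarrow> bool" where
  "prime_in B P \<longleftrightarrow> P \<subseteq> B \<and> 0 \<in> P \<and> 1 \<notin> P \<and> (\<forall>a\<in>P. \<forall>b\<in>P. a + b \<in> P) \<and>
     (\<forall>a\<in>P. \<forall>b\<in>B. b * a \<in> P) \<and> (\<forall>a\<in>B. \<forall>b\<in>B. a * b \<in> P \<longrightarrow> a \<in> P \<or> b \<in> P)"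

definition unital_hom :: "('r::comm_ring_1 \<Rightarrow> 'k::comm_ring_1) \<Rightarrow> bool" where
  "unital_hom \<phi> \<longleftrightarrow> \<phi> 0 = 0 \<and> \<phi> 1 = 1 \<and> (\<forall>a b. \<phi> (a + b) = \<phi> a + \<phi> b) \<and> (\<forall>a b. \<phi> (a * b) = \<phi> a * \<phi> b)"

lemma unital_hom_simps:
  assumes "unital_hom \<phi>"
  shows "\<phi> 0 = 0" "\<phi> 1 = 1" "\<phi> (a + b) = \<phi> a + \<phi> b" "\<phi> (a * b) = \<phi> a * \<phi> b"
    "\<phi> (a - b) = \<phi> a - \<phi> b" "\<phi> (a ^ k) = \<phi> a ^ k" "\<phi> (sum f I) = (\<Sum>i\<in>I. \<phi> (f i))"
proof -
  show *: "\<phi> 0 = 0" "\<phi> 1 = 1" "\<And>a b. \<phi> (a + b) = \<phi> a + \<phi> b" "\<And>a b. \<phi> (a * b) = \<phi> a * \<phi> b"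
    using assms by (auto simp: unital_hom_def)
  show "\<phi> (a - b) = \<phi> a - \<phi> b" using *(3)[of "a - b" b] by simp
  show "\<phi> (a ^ k) = \<phi> a ^ k" by (induction k) (simp_all add: *)
  show "\<phi> (sum f I) = (\<Sum>i\<in>I. \<phi> (f i))"
    by (induction I rule: infinite_finite_induct) (simp_all add: *)
qed

lemma unital_hom_map_poly:
  assumes "unital_hom \<phi>"
  shows "unital_hom (map_poly \<phi>)"
  unfolding unital_hom_def
  by (auto intro!: poly_eqI simp: coeff_map_poly coeff_mult coeff_1 unital_hom_simps[OF assms])

text \<open>
  A polynomial of positive degree takes the value \<open>1\<close>.
\<close>

lemma alg_closed_nonroot:
  fixes p :: "'k::alg_closed_field poly"
  assumes "p \<noteq> 0"
  shows "\<exists>\<xi>. poly p \<xi> \<noteq> 0"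
proof (cases "degree p = 0")
  case True
  with assms show ?thesis by (auto elim!: degree_eq_zeroE)
next
  case False
  have "degree (p - [:1:]) = degree p"
    using False degree_add_eq_left[of "[:-1:]" p] by (simp add: diff_conv_add_uminus del: add_uminus_conv_diff)
  with False obtain \<xi> where "poly (p - [:1:]) \<xi> = 0"
    using alg_closed_imp_poly_has_root[of "p - [:1:]"] by auto
  then show ?thesis by (intro exI[of _ \<xi>]) auto
qed

locale prime_over_subring = B: subring_set B + S: subring_set S for B S :: "'r::comm_ring_1 set" +
  fixes P x
  assumes sub: "S \<subseteq> B" and prime: "prime_in B P" and xB: "x \<in> B"
begin

lemma P_add: "a \<in> P \<Longrightarrow> b \<in> P \<Longrightarrow> a + b \<in> P"
  and P_mult: "a \<in> P \<Longrightarrow> b \<in> B \<Longrightarrow> b * a \<in> P"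
  and P_zero: "0 \<in> P" and P_one: "1 \<notin> P"
  and P_prime: "a \<in> B \<Longrightarrow> b \<in> B \<Longrightarrow> a * b \<in> P \<Longrightarrow> a \<in> P \<or> b \<in> P"
  using prime by (auto simp: prime_in_def)

lemma P_uminus: "a \<in> P \<Longrightarrow> - a \<in> P"
  using P_mult[of a "-1"] B.uminus_closed[OF B.one_closed] by simp

lemma P_diff: "a \<in> P \<Longrightarrow> b \<in> P \<Longrightarrow> a - b \<in> P"
  using P_add[OF _ P_uminus, of a b] by simp

lemma P_sum: "(\<And>i. i \<in> I \<Longrightarrow> f i \<in> P) \<Longrightarrow> sum f I \<in> P"
  by (induction I rule: infinite_finite_induct) (simp_all add: P_zero P_add)

lemma P_cong: "a - b \<in> P \<Longrightarrow> a \<in> P \<longleftrightarrow> b \<in> P"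
  using P_add[of "a - b" b] P_diff[of a "a - b"] by auto

lemma P_power: "c \<in> B \<Longrightarrow> c ^ k \<in> P \<Longrightarrow> c \<in> P"
  by (induction k) (use P_one P_prime B.power_closed in auto)

lemma poly_mem_B: "p \<in> polys_over S \<Longrightarrow> poly p x \<in> B"
  using B.poly_closed[OF _ xB] polys_over_mono[OF sub] by blast

lemma poly_mem_P: "p \<in> polys_over P \<Longrightarrow> poly p x \<in> P"
  unfolding poly_altdef
  by (intro P_sum) (metis P_mult B.power_closed mult.commute polys_overD xB)

text \<open>
  Polynomials over \<open>S\<close> are used as representatives of polynomials over the domain of
  residue classes of \<open>S\<close> modulo \<open>P\<close>. The reduced representative has the degree of the residue
  class as its degree, so that its leading coefficient is not in \<open>P\<close>.
\<close>

definition reduce :: "'r poly \<Rightarrow> 'r poly" where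
  "reduce g = map_poly (\<lambda>c. if c \<in> P then 0 else c) g"

lemma coeff_reduce: "coeff (reduce g) i = (if coeff g i \<in> P then 0 else coeff g i)"
  by (simp add: reduce_def coeff_map_poly)

lemma reduce_polys_over: "g \<in> polys_over S \<Longrightarrow> reduce g \<in> polys_over S"
  by (auto simp: polys_over_def coeff_reduce S.zero_closed)

lemma reduce_eq_0_iff: "reduce g = 0 \<longleftrightarrow> g \<in> polys_over P"
  by (auto simp: poly_eq_iff polys_over_def coeff_reduce P_zero)

lemma poly_reduce: "poly (reduce g) x - poly g x \<in> P"
proof -
  have "reduce g - g \<in> polys_over P"
    by (auto simp: polys_over_def coeff_reduce P_zero P_uminus)
  from poly_mem_P[OF this] show ?thesis by simp
qed

lemma lead_coeff_reduce: "reduce g \<noteq> 0 \<Longrightarrow> lead_coeff (reduce g) \<notin> P"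
  using leading_coeff_neq_0[of "reduce g"] unfolding coeff_reduce by presburger

lemma degree_reduce_less:
  assumes "\<And>i. d \<le> i \<Longrightarrow> coeff g i = 0" and "reduce g \<noteq> 0"
  shows "degree (reduce g) < d"
  using assms leading_coeff_neq_0[of "reduce g"] unfolding coeff_reduce
  by (metis linorder_not_less)

text \<open>
  If \<open>x\<close> satisfies no equation over \<open>S\<close> modulo \<open>P\<close>, then every value \<open>\<xi>\<close> for \<open>x\<close> is
  compatible with \<open>P\<close>, and one only has to avoid the roots of the image of \<open>bh\<close>; this image
  is nonzero if \<open>\<phi>\<close> does not kill some coefficient \<open>r\<close> of \<open>bh\<close>.

  Otherwise take an equation \<open>f\<close> of least degree, with leading coefficient \<open>c\<close>, and let
  \<open>\<xi>\<close> be a root of its image. Pseudo-division shows that \<open>\<xi>\<close> satisfies all the equations of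
  \<open>x\<close>. As \<open>f\<close> is irreducible over the fraction field of the residue classes, it is coprime
  to \<open>bh\<close>, which does not vanish at \<open>x\<close>; so some multiple of \<open>b\<close> is congruent to an element \<open>e\<close> of \<open>S\<close> outside of \<open>P\<close>;
  then \<open>r = c e\<close> works.
\<close>

lemma extension_step:
  assumes bh: "bh \<in> polys_over S" and b: "poly bh x \<notin> P"
  shows "\<exists>r \<in> S - P. \<forall>\<phi>::'r \<Rightarrow> 'k::alg_closed_field.
           unital_hom \<phi> \<and> (\<forall>p \<in> P \<inter> S. \<phi> p = 0) \<and> \<phi> r \<noteq> 0 \<longrightarrow>
           (\<exists>\<xi>. (\<forall>q \<in> polys_over S. poly q x \<in> P \<longrightarrow> poly (map_poly \<phi> q) \<xi> = 0) \<and>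
                poly (map_poly \<phi> bh) \<xi> \<noteq> 0)"
proof (cases "\<forall>q \<in> polys_over S. poly q x \<in> P \<longrightarrow> q \<in> polys_over P")
  case True
  from b obtain i where i: "coeff bh i \<notin> P"
    using poly_mem_P[of bh] by (auto simp: polys_over_def)
  show ?thesis
  proof (rule bexI[of _ "coeff bh i"], intro allI impI, elim conjE)
    fix \<phi> :: "'r \<Rightarrow> 'k"
    assume \<phi>: "unital_hom \<phi>" "\<forall>p \<in> P \<inter> S. \<phi> p = 0" "\<phi> (coeff bh i) \<noteq> 0"
    note h = unital_hom_simps[OF \<phi>(1)]
    have "coeff (map_poly \<phi> bh) i \<noteq> 0" using \<phi>(3) by (simp add: coeff_map_poly h)
    then have "map_poly \<phi> bh \<noteq> 0" by auto
    then obtain \<xi> where "poly (map_poly \<phi> bh) \<xi> \<noteq> 0" using alg_closed_nonroot by blast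
    moreover have "map_poly \<phi> q = 0" if "q \<in> polys_over S" "poly q x \<in> P" for q
      using True that \<phi>(2) by (intro poly_eqI) (auto simp: coeff_map_poly h polys_over_def)
    ultimately show "\<exists>\<xi>. (\<forall>q \<in> polys_over S. poly q x \<in> P \<longrightarrow> poly (map_poly \<phi> q) \<xi> = 0) \<and>
                poly (map_poly \<phi> bh) \<xi> \<noteq> 0"
      by auto
  qed (use i bh in \<open>auto simp: polys_over_def\<close>)
next
  case False
  interpret SP: subring_set "polys_over S" by (rule S.subring_polys_over)
  \<comment> \<open>\<open>F\<close> collects the equations of \<open>x\<close>; \<open>f\<close> is one of least degree.\<close>
  define F where "F = (\<lambda>f. f \<in> polys_over S \<and> reduce f = f \<and> f \<noteq> 0 \<and> poly f x \<in> P)"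
  define f where "f = arg_min degree F"
  have reduce_idem: "reduce (reduce g) = reduce g" for g
    by (auto simp: poly_eq_iff coeff_reduce)
  from False obtain g where "g \<in> polys_over S" "poly g x \<in> P" "reduce g \<noteq> 0"
    by (auto simp: reduce_eq_0_iff)
  then have "F (reduce g)"
    using P_cong[OF poly_reduce[of g]] by (auto simp: F_def reduce_polys_over reduce_idem)
  then have f: "F f" and f_min: "\<And>g. F g \<Longrightarrow> degree f \<le> degree g"
    unfolding f_def by (auto intro: arg_min_natI arg_min_nat_le)
  define c where "c = lead_coeff f"
  define d where "d = degree f"
  have fS: "f \<in> polys_over S" and fP: "poly f x \<in> P" using f by (auto simp: F_def)
  have cP: "c \<notin> P" unfolding c_def using lead_coeff_reduce[of f] f by (simp add: F_def)
  have cS: "c \<in> S" unfolding c_def using fS by (rule polys_overD)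
  have d0: "0 < d"
  proof (rule ccontr)
    assume "\<not> 0 < d"
    then obtain a where "f = [:a:]" unfolding d_def by (auto elim: degree_eq_zeroE)
    with fP cP show False by (simp add: c_def)
  qed
  \<comment> \<open>The minimality of \<open>f\<close>, in the form in which remainders can be discarded.\<close>
  have small: "r \<in> polys_over P"
    if "r \<in> polys_over S" "poly r x \<in> P" "\<And>i. d \<le> i \<Longrightarrow> coeff r i = 0" for r
  proof (rule ccontr)
    assume "r \<notin> polys_over P"
    then have nz: "reduce r \<noteq> 0" by (simp add: reduce_eq_0_iff)
    then have "F (reduce r)"
      using that P_cong[OF poly_reduce[of r]] by (auto simp: F_def reduce_polys_over reduce_idem)
    from f_min[OF this] degree_reduce_less[of d r, OF that(3) nz] show False by (simp add: d_def)
  qed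
  \<comment> \<open>Bezout coefficients for \<open>f\<close> and \<open>bh\<close>: \<open>H\<close> collects the polynomials whose value at \<open>x\<close>
      is a nonzero multiple of \<open>b\<close> modulo \<open>P\<close>. One of least degree turns out to be constant.\<close>
  define H where "H = (\<lambda>h. h \<in> polys_over S \<and> reduce h = h \<and> poly h x \<notin> P \<and>
      (\<exists>v \<in> polys_over S. poly h x - poly v x * poly bh x \<in> P))"
  have H_reduce: "H (reduce g)"
    if g: "g \<in> polys_over S" "poly g x \<notin> P" "v \<in> polys_over S"
      "poly g x - poly v x * poly bh x \<in> P" for g v
    unfolding H_def
  proof (intro conjI bexI)
    show "poly (reduce g) x - poly v x * poly bh x \<in> P"
      using P_add[OF poly_reduce[of g] g(4)] by simp
    show "poly (reduce g) x \<notin> P" using g(2) P_cong[OF poly_reduce[of g]] by simp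
  qed (use g in \<open>auto simp: reduce_idem reduce_polys_over\<close>)
  define h where "h = arg_min degree H"
  have "H (reduce bh)"
    using H_reduce[OF bh b SP.one_closed] by (simp add: P_zero)
  then have h: "H h" and h_min: "\<And>g. H g \<Longrightarrow> degree h \<le> degree g"
    unfolding h_def by (auto intro: arg_min_natI arg_min_nat_le)
  then obtain v where v: "v \<in> polys_over S" and hv: "poly h x - poly v x * poly bh x \<in> P"
    by (auto simp: H_def)
  have hS: "h \<in> polys_over S" and hP: "poly h x \<notin> P" using h by (auto simp: H_def)
  have h0: "h \<noteq> 0" using hP P_zero by auto
  have H_small: "degree h < k"
    if "g \<in> polys_over S" "poly g x \<notin> P" "w \<in> polys_over S"
      "poly g x - poly w x * poly bh x \<in> P" "\<And>i. k \<le> i \<Longrightarrow> coeff g i = 0" for g w k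
  proof -
    have "H (reduce g)" by (rule H_reduce) (use that in auto)
    then have "degree h \<le> degree (reduce g)" by (rule h_min)
    also have "\<dots> < k"
      using \<open>H (reduce g)\<close> P_zero by (intro degree_reduce_less that) (auto simp: H_def)
    finally show ?thesis .
  qed
  \<comment> \<open>The remainder of \<open>h\<close> modulo \<open>f\<close> is again in \<open>H\<close>.\<close>
  have "degree h < d"
  proof -
    obtain k q r where q: "q \<in> polys_over S" and r: "r \<in> polys_over S"
      and eq: "smult (c ^ k) h = q * f + r" and r0: "\<forall>i\<ge>d. coeff r i = 0"
      using S.pseudo_division[OF fS hS, of "Suc (degree h)"] coeff_eq_0[of h]
      unfolding c_def d_def by (metis Suc_le_eq)
    have *: "poly r x = c ^ k * poly h x - poly q x * poly f x"
      using arg_cong[OF eq, of "\<lambda>p. poly p x"] by simp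
    have qf: "poly q x * poly f x \<in> P" by (intro P_mult fP poly_mem_B q)
    have ckB: "c ^ k \<in> B" using S.power_closed[OF cS] sub by blast
    have "c ^ k * poly h x \<notin> P"
      using P_prime[OF ckB poly_mem_B[OF hS]] hP cP P_power[of c k] cS sub by blast
    then have rP: "poly r x \<notin> P"
      using P_cong[of "c ^ k * poly h x" "poly r x"] qf by (simp add: *)
    have "poly r x - poly (smult (c ^ k) v) x * poly bh x =
        c ^ k * (poly h x - poly v x * poly bh x) - poly q x * poly f x"
      by (simp add: * algebra_simps)
    also have "\<dots> \<in> P" by (intro P_diff P_mult hv qf ckB)
    finally show ?thesis
      using r0 by (intro H_small[OF r rP S.smult_polys_over[OF S.power_closed[OF cS] v]]) auto
  qed
  \<comment> \<open>The remainder of \<open>f\<close> modulo a nonconstant \<open>h\<close> would be in \<open>H\<close> or an equation of \<open>x\<close>. In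
      the second case \<open>f\<close> would factor modulo \<open>P\<close> as \<open>h\<close> times a quotient \<open>q\<close> of degree less
      than \<open>d\<close>, which would be a smaller equation.\<close>
  have "degree h = 0"
  proof (rule ccontr)
    assume h_pos: "degree h \<noteq> 0"
    define a where "a = lead_coeff h"
    have aP: "a \<notin> P"
      unfolding a_def using lead_coeff_reduce[of h] h h0 by (simp add: H_def)
    have aS: "a \<in> S" unfolding a_def using hS by (rule polys_overD)
    obtain k q r where q: "q \<in> polys_over S" and r: "r \<in> polys_over S"
      and eq: "smult (a ^ k) f = q * h + r" and r0: "\<forall>i\<ge>degree h. coeff r i = 0"
      and q0: "\<forall>i. Suc d \<le> i + degree h \<longrightarrow> coeff q i = 0"
      using S.pseudo_division[OF hS fS, of "Suc d"] coeff_eq_0[of f]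
      unfolding a_def d_def by (metis Suc_le_eq)
    have *: "poly r x = a ^ k * poly f x - poly q x * poly h x"
      using arg_cong[OF eq, of "\<lambda>p. poly p x"] by simp
    have akB: "a ^ k \<in> B" using S.power_closed[OF aS] sub by blast
    have af: "a ^ k * poly f x \<in> P" by (intro P_mult fP akB)
    have "poly r x \<in> P"
    proof (rule ccontr)
      assume rP: "poly r x \<notin> P"
      have "poly r x - poly (- (q * v)) x * poly bh x =
          a ^ k * poly f x - poly q x * (poly h x - poly v x * poly bh x)"
        by (simp add: * algebra_simps)
      also have "\<dots> \<in> P" by (intro P_diff P_mult hv af poly_mem_B q)
      finally have "degree h < degree h"
        using r0 by (intro H_small[OF r rP SP.uminus_closed[OF SP.mult_closed[OF q v]]]) auto
      then show False by simp
    qed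
    then have "poly q x * poly h x \<in> P"
      using P_cong[of "a ^ k * poly f x" "poly q x * poly h x"] af by (simp add: *)
    then have "poly q x \<in> P" using P_prime poly_mem_B q hS hP by blast
    then have "q \<in> polys_over P" using q0 h_pos by (intro small q) auto
    then have "coeff (q * h) d \<in> P"
      unfolding coeff_mult using hS sub
      by (intro P_sum) (metis P_mult mult.commute polys_overD subsetD)
    moreover have "coeff (q * h) d = a ^ k * c"
      using arg_cong[OF eq, of "\<lambda>p. coeff p d"] r0 \<open>degree h < d\<close> by (simp add: c_def d_def)
    ultimately show False
      using P_prime[OF akB] cP aP P_power[of a k] aS cS sub by auto
  qed
  then obtain e where he: "h = [:e:]" by (auto elim: degree_eq_zeroE)
  have eS: "e \<in> S" using polys_overD[OF hS, of 0] by (simp add: he)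
  have eP: "e \<notin> P" using hP by (simp add: he)
  show ?thesis
  proof (rule bexI[of _ "c * e"], intro allI impI, elim conjE)
    fix \<phi> :: "'r \<Rightarrow> 'k"
    assume \<phi>: "unital_hom \<phi>" "\<forall>p \<in> P \<inter> S. \<phi> p = 0" "\<phi> (c * e) \<noteq> 0"
    note \<phi>h = unital_hom_simps[OF \<phi>(1)]
    note \<phi>p = unital_hom_simps[OF unital_hom_map_poly[OF \<phi>(1)]]
    have "\<phi> c \<noteq> 0" and "\<phi> e \<noteq> 0" using \<phi>(3) by (auto simp: \<phi>h)
    have "coeff (map_poly \<phi> f) d \<noteq> 0"
      using \<open>\<phi> c \<noteq> 0\<close> by (simp add: coeff_map_poly \<phi>h c_def d_def)
    then have "d \<le> degree (map_poly \<phi> f)" by (rule le_degree)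
    then obtain \<xi> where \<xi>: "poly (map_poly \<phi> f) \<xi> = 0"
      using alg_closed_imp_poly_has_root[of "map_poly \<phi> f"] d0 by auto
    have killed: "poly (map_poly \<phi> q) \<xi> = 0" if q: "q \<in> polys_over S" "poly q x \<in> P" for q
    proof -
      obtain k u r where u: "u \<in> polys_over S" and r: "r \<in> polys_over S"
        and eq: "smult (c ^ k) q = u * f + r" and r0: "\<forall>i\<ge>d. coeff r i = 0"
        using S.pseudo_division[OF fS q(1), of "Suc (degree q)"] coeff_eq_0[of q]
        unfolding c_def d_def by (metis Suc_le_eq)
      have "poly r x = c ^ k * poly q x - poly u x * poly f x"
        using arg_cong[OF eq, of "\<lambda>p. poly p x"] by simp
      also have "\<dots> \<in> P"
        using S.power_closed[OF cS] sub by (intro P_diff P_mult q fP poly_mem_B u) auto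
      finally have "r \<in> polys_over P" using r0 by (intro small r) auto
      then have "map_poly \<phi> r = 0"
        using r \<phi>(2) by (intro poly_eqI) (auto simp: coeff_map_poly \<phi>h polys_over_def)
      moreover have "map_poly \<phi> (smult (c ^ k) q) = smult (\<phi> c ^ k) (map_poly \<phi> q)"
        by (intro poly_eqI) (simp add: coeff_map_poly \<phi>h)
      ultimately have "smult (\<phi> c ^ k) (map_poly \<phi> q) = map_poly \<phi> u * map_poly \<phi> f"
        using arg_cong[OF eq, of "map_poly \<phi>"] by (simp add: \<phi>p)
      then have "\<phi> c ^ k * poly (map_poly \<phi> q) \<xi> = poly (map_poly \<phi> u) \<xi> * poly (map_poly \<phi> f) \<xi>"
        by (metis poly_mult poly_smult)
      with \<xi> \<open>\<phi> c \<noteq> 0\<close> show ?thesis by simp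
    qed
    have "h - v * bh \<in> polys_over S"
      by (intro SP.diff_closed SP.mult_closed hS v bh)
    then have "poly (map_poly \<phi> (h - v * bh)) \<xi> = 0"
      using hv by (intro killed) simp_all
    then have "\<phi> e = poly (map_poly \<phi> v) \<xi> * poly (map_poly \<phi> bh) \<xi>"
      by (simp add: \<phi>p he map_poly_pCons \<phi>h)
    with \<open>\<phi> e \<noteq> 0\<close> have "poly (map_poly \<phi> bh) \<xi> \<noteq> 0" by auto
    with killed show "\<exists>\<xi>. (\<forall>q \<in> polys_over S. poly q x \<in> P \<longrightarrow> poly (map_poly \<phi> q) \<xi> = 0) \<and>
                poly (map_poly \<phi> bh) \<xi> \<noteq> 0"
      by blast
  qed (use P_prime[of c e] cS eS cP eP sub S.mult_closed in auto)
qed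

end

section \<open>Monoid algebras and their characters\<close>

text \<open>
  The linear extension of a function on the monoid to the monoid algebra.
\<close>

definition monoid_eval :: "('m \<Rightarrow> 'k) \<Rightarrow> ('m \<Rightarrow>\<^sub>0 'k::comm_ring_1) \<Rightarrow> 'k" where
  "monoid_eval \<chi> f = (\<Sum>a\<in>Poly_Mapping.keys f. Poly_Mapping.lookup f a * \<chi> a)"

definition monoid_character :: "('m::comm_monoid_add \<Rightarrow> 'k::comm_ring_1) \<Rightarrow> bool" where
  "monoid_character \<chi> \<longleftrightarrow> \<chi> 0 = 1 \<and> (\<forall>a b. \<chi> (a + b) = \<chi> a * \<chi> b)"

definition monoid_ring :: "'m set \<Rightarrow> ('m \<Rightarrow>\<^sub>0 'k::comm_ring_1) set" where
  "monoid_ring W = {f. Poly_Mapping.keys f \<subseteq> W}"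

text \<open>
  The submonoid generated by \<open>G\<close>. Adding one generator at a time gives an induction rule
  that peels off a single generator.
\<close>

inductive_set submonoid_span :: "'m::comm_monoid_add set \<Rightarrow> 'm set" for G where
  zero: "0 \<in> submonoid_span G"
| add: "g \<in> G \<Longrightarrow> w \<in> submonoid_span G \<Longrightarrow> g + w \<in> submonoid_span G"

lemma submonoid_span_add:
  "a \<in> submonoid_span G \<Longrightarrow> b \<in> submonoid_span G \<Longrightarrow> a + b \<in> submonoid_span G"
  by (induction rule: submonoid_span.induct) (simp_all add: add.assoc submonoid_span.add)

lemma submonoid_span_base: "g \<in> G \<Longrightarrow> g \<in> submonoid_span G"
  using submonoid_span.add[OF _ submonoid_span.zero, of g G] by simp

lemma monoid_eval_superset:
  assumes "finite A" and "Poly_Mapping.keys f \<subseteq> A"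
  shows "monoid_eval \<chi> f = (\<Sum>a\<in>A. Poly_Mapping.lookup f a * \<chi> a)"
  unfolding monoid_eval_def
  by (rule sum.mono_neutral_left) (use assms in \<open>auto simp: in_keys_iff\<close>)

lemma monoid_eval_single [simp]: "monoid_eval \<chi> (Poly_Mapping.single a c) = c * \<chi> a"
  by (simp add: monoid_eval_def)

lemma monoid_eval_zero [simp]: "monoid_eval \<chi> 0 = 0"
  by (simp add: monoid_eval_def)

lemma monoid_eval_add: "monoid_eval \<chi> (f + g) = monoid_eval \<chi> f + monoid_eval \<chi> g"
proof -
  let ?A = "Poly_Mapping.keys f \<union> Poly_Mapping.keys g"
  have "monoid_eval \<chi> h = (\<Sum>a\<in>?A. Poly_Mapping.lookup h a * \<chi> a)"
    if "h \<in> {f, g, f + g}" for h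
    using that keys_add[of f g] by (intro monoid_eval_superset) auto
  then show ?thesis by (simp add: lookup_add sum.distrib distrib_right)
qed

lemma monoid_eval_sum: "monoid_eval \<chi> (sum F I) = (\<Sum>i\<in>I. monoid_eval \<chi> (F i))"
  by (induction I rule: infinite_finite_induct) (simp_all add: monoid_eval_add)

lemma poly_mapping_sum_singles:
  "(\<Sum>a\<in>Poly_Mapping.keys f. Poly_Mapping.single a (Poly_Mapping.lookup f a)) = f"
  by (rule poly_mapping_eqI)
    (auto simp: lookup_sum lookup_single when_def in_keys_iff sum.delta)

lemma monoid_eval_mult:
  assumes "monoid_character \<chi>"
  shows "monoid_eval \<chi> (f * g) = monoid_eval \<chi> f * monoid_eval \<chi> g"
proof -
  let ?l = Poly_Mapping.lookup and ?s = Poly_Mapping.single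
  have "monoid_eval \<chi> (f * g) =
      monoid_eval \<chi> ((\<Sum>a\<in>Poly_Mapping.keys f. ?s a (?l f a)) * (\<Sum>b\<in>Poly_Mapping.keys g. ?s b (?l g b)))"
    by (simp add: poly_mapping_sum_singles)
  also have "\<dots> = monoid_eval \<chi> f * monoid_eval \<chi> g"
    unfolding monoid_eval_def[of \<chi> f] monoid_eval_def[of \<chi> g]
    using assms
    by (simp add: sum_product monoid_eval_sum mult_single monoid_character_def mult_ac)
  finally show ?thesis .
qed

lemma unital_hom_monoid_eval:
  assumes "monoid_character \<chi>"
  shows "unital_hom (monoid_eval \<chi>)"
proof -
  have "monoid_eval \<chi> (Poly_Mapping.single 0 1) = 1"
    using assms by (simp only: monoid_eval_single) (simp add: monoid_character_def)
  then show ?thesis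
    by (simp add: unital_hom_def monoid_eval_add monoid_eval_mult[OF assms])
qed

lemma subring_monoid_ring:
  assumes "0 \<in> W" and "\<And>a b. a \<in> W \<Longrightarrow> b \<in> W \<Longrightarrow> a + b \<in> W"
  shows "subring_set (monoid_ring W)"
proof
  fix f g :: "'a \<Rightarrow>\<^sub>0 'b"
  assume "f \<in> monoid_ring W" and "g \<in> monoid_ring W"
  then have fg: "Poly_Mapping.keys f \<subseteq> W" "Poly_Mapping.keys g \<subseteq> W"
    by (simp_all add: monoid_ring_def)
  have "Poly_Mapping.keys (f - g) \<subseteq> Poly_Mapping.keys f \<union> Poly_Mapping.keys g"
    by (auto simp: in_keys_iff lookup_minus)
  with fg show "f - g \<in> monoid_ring W" by (auto simp: monoid_ring_def)
  have "Poly_Mapping.keys (f * g) \<subseteq> W"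
    using keys_mult[of f g] fg by (blast intro: assms(2))
  then show "f * g \<in> monoid_ring W" by (simp add: monoid_ring_def)
qed (use assms in \<open>simp add: monoid_ring_def\<close>)

lemma subring_span: "subring_set (monoid_ring (submonoid_span G))"
  by (rule subring_monoid_ring[OF submonoid_span.zero submonoid_span_add])

lemma single_monoid_ring: "a \<in> W \<Longrightarrow> Poly_Mapping.single a c \<in> monoid_ring W"
  by (simp add: monoid_ring_def)

section \<open>Subrings as rings with explicit carrier\<close>

lemma ring_on_simps [simp]:
  "carrier (ring_on A) = A" "monoid.mult (ring_on A) = (*)" "one (ring_on A) = 1"
  "zero (ring_on A) = 0" "add (ring_on A) = (+)"
  by (simp_all add: ring_on_def)

context subring_set
begin

lemma cring_ring_on: "cring (ring_on S)"
proof (intro cringI abelian_groupI comm_monoidI)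
  fix x assume "x \<in> carrier (ring_on S)"
  then show "\<exists>y\<in>carrier (ring_on S). y \<oplus>\<^bsub>ring_on S\<^esub> x = \<zero>\<^bsub>ring_on S\<^esub>"
    by (intro bexI[of _ "- x"]) (auto simp: uminus_closed)
qed (auto simp: add_closed mult_closed one_closed zero_closed algebra_simps)

lemma ideal_ring_on_iff:
  "ideal I (ring_on S) \<longleftrightarrow> I \<subseteq> S \<and> 0 \<in> I \<and> (\<forall>a\<in>I. \<forall>b\<in>I. a + b \<in> I) \<and> (\<forall>a\<in>I. \<forall>b\<in>S. b * a \<in> I)"
    (is "_ \<longleftrightarrow> ?R")
proof
  assume "ideal I (ring_on S)"
  then interpret I: ideal I "ring_on S" .
  show ?R
    using I.a_subset additive_subgroup.zero_closed[OF I.additive_subgroup_axioms]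
      additive_subgroup.a_closed[OF I.additive_subgroup_axioms] I.I_l_closed by auto
next
  assume R: ?R
  interpret R: cring "ring_on S" by (rule cring_ring_on)
  have neg: "inv\<^bsub>add_monoid (ring_on S)\<^esub> a = - a" if "a \<in> S" for a
    using R.minus_equality[of "- a" a] that by (simp add: a_inv_def uminus_closed)
  have "- a \<in> I" if "a \<in> I" for a
    using R that uminus_closed[OF one_closed] by force
  then show "ideal I (ring_on S)"
    using R by (intro idealI R.ring_axioms subgroup.intro) (auto simp: neg[simplified] subset_iff mult.commute)
qed

text \<open>
  Passes from the locale of maximal ideals to the formulation of primality without records.
\<close>

lemma maximal_imp_prime_in:
  assumes "maximalideal M (ring_on S)"
  shows "prime_in S M"
proof -
  interpret R: cring "ring_on S" by (rule cring_ring_on)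
  interpret M: primeideal M "ring_on S" by (rule R.maximalideal_prime[OF assms])
  have "1 \<notin> M" using M.one_imp_carrier M.I_notcarr by auto
  then show ?thesis
    using M.I_prime M.ideal_axioms[unfolded ideal_ring_on_iff] by (auto simp: prime_in_def)
qed

text \<open>
  An ideal that contains the kernel and some \<open>a\<close> outside of it contains \<open>b a\<close> and \<open>1 - b a\<close>,
  where \<open>\<phi> b\<close> is the inverse of \<open>\<phi> a\<close>.
\<close>

lemma maximalideal_kernel:
  fixes \<phi> :: "'r \<Rightarrow> 'k::field"
  assumes "unital_hom \<phi>" and surj: "\<And>c. \<exists>a\<in>S. \<phi> a = c"
  shows "maximalideal {a \<in> S. \<phi> a = 0} (ring_on S)"
proof (rule maximalidealI)
  note h = unital_hom_simps[OF assms(1)]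
  show "ideal {a \<in> S. \<phi> a = 0} (ring_on S)"
    unfolding ideal_ring_on_iff by (auto simp: h zero_closed add_closed mult_closed)
  have "1 \<notin> {a \<in> S. \<phi> a = 0}" using h(2) by simp
  then show "carrier (ring_on S) \<noteq> {a \<in> S. \<phi> a = 0}"
    using one_closed by (metis ring_on_simps(1))
  fix J assume J: "ideal J (ring_on S)" "{a \<in> S. \<phi> a = 0} \<subseteq> J" "J \<subseteq> carrier (ring_on S)"
  note J' = J(1)[unfolded ideal_ring_on_iff]
  show "J = {a \<in> S. \<phi> a = 0} \<or> J = carrier (ring_on S)"
  proof (cases "J \<subseteq> {a \<in> S. \<phi> a = 0}")
    case False
    then obtain a where a: "a \<in> J" "\<phi> a \<noteq> 0" "a \<in> S" using J' by auto
    obtain b where b: "b \<in> S" "\<phi> b = 1 / \<phi> a" using surj by blast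
    have "1 - b * a \<in> J"
      using a b J(2) by (intro subsetD[OF J(2)]) (auto simp: h diff_closed mult_closed one_closed)
    moreover have "b * a \<in> J" using J' a b by blast
    ultimately have "1 - b * a + b * a \<in> J" using J' by blast
    then have "1 \<in> J" by simp
    then have "S \<subseteq> J" using J' by (metis mult_1_right subsetI)
    with J' show ?thesis by auto
  qed (use J in blast)
qed

end

section \<open>The ideal of a character\<close>

context
  fixes G :: "'m::comm_monoid_add set" and \<chi> :: "'m \<Rightarrow> 'k::field"
  assumes \<chi>: "monoid_character \<chi>"
begin

lemma maximalideal_monoid_eval:
  "maximalideal {f \<in> monoid_ring (submonoid_span G). monoid_eval \<chi> f = 0}
     (ring_on (monoid_ring (submonoid_span G)))"
proof (rule subring_set.maximalideal_kernel[OF subring_span unital_hom_monoid_eval[OF \<chi>]])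
  fix c
  have "\<chi> 0 = 1" using \<chi> by (simp add: monoid_character_def)
  then have "monoid_eval \<chi> (Poly_Mapping.single 0 c) = c" by simp
  then show "\<exists>a\<in>monoid_ring (submonoid_span G). monoid_eval \<chi> a = c"
    by (rule bexI[OF _ single_monoid_ring[OF submonoid_span.zero]])
qed

text \<open>
  Modulo the generators every \<open>g \<in> G\<close> is congruent to the scalar \<open>\<chi> g\<close>, hence so is every
  element of the monoid to its value, and every \<open>f\<close> to its evaluation. So an \<open>f\<close> with
  evaluation \<open>0\<close> lies in the ideal.
\<close>

lemma genideal_eq_kernel:
  "Idl\<^bsub>ring_on (monoid_ring (submonoid_span G))\<^esub>
     {Poly_Mapping.single g 1 - Poly_Mapping.single 0 (\<chi> g) | g. g \<in> G} =
   {f \<in> monoid_ring (submonoid_span G). monoid_eval \<chi> f = 0}"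
  (is "Idl\<^bsub>?R\<^esub> ?G = ?K")
proof
  interpret A: subring_set "monoid_ring (submonoid_span G) :: ('m \<Rightarrow>\<^sub>0 'k) set"
    by (rule subring_span)
  interpret R: cring ?R by (rule A.cring_ring_on)
  note h = unital_hom_simps[OF unital_hom_monoid_eval[OF \<chi>]]
  have \<chi>': "\<chi> 0 = 1" "\<And>a b. \<chi> (a + b) = \<chi> a * \<chi> b"
    using \<chi> by (auto simp: monoid_character_def)
  note [intro] = single_monoid_ring submonoid_span.zero submonoid_span_base
  have gens: "?G \<subseteq> ?K"
  proof
    fix f assume "f \<in> ?G"
    then obtain g where g: "g \<in> G" "f = Poly_Mapping.single g 1 - Poly_Mapping.single 0 (\<chi> g)"
      by blast
    have "monoid_eval \<chi> f = 0" unfolding g(2) h(5) by (simp add: \<chi>'(1))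
    moreover have "f \<in> monoid_ring (submonoid_span G)"
      unfolding g(2) using g(1) by (intro A.diff_closed) auto
    ultimately show "f \<in> ?K" by simp
  qed
  have K: "ideal ?K ?R"
    using maximalideal_monoid_eval maximalideal.axioms(1) by blast
  show "Idl\<^bsub>?R\<^esub> ?G \<subseteq> ?K" by (rule R.genideal_minimal[OF K gens])
  have I: "ideal (Idl\<^bsub>?R\<^esub> ?G) ?R" and GI: "?G \<subseteq> Idl\<^bsub>?R\<^esub> ?G"
    using gens by (auto intro!: R.genideal_ideal R.genideal_self)
  note I' = I[unfolded A.ideal_ring_on_iff]
  have I_add: "\<And>a b. a \<in> Idl\<^bsub>?R\<^esub> ?G \<Longrightarrow> b \<in> Idl\<^bsub>?R\<^esub> ?G \<Longrightarrow> a + b \<in> Idl\<^bsub>?R\<^esub> ?G"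
    and I_mult: "\<And>a b. a \<in> Idl\<^bsub>?R\<^esub> ?G \<Longrightarrow> b \<in> monoid_ring (submonoid_span G) \<Longrightarrow> b * a \<in> Idl\<^bsub>?R\<^esub> ?G"
    using I' by blast+
  let ?s = Poly_Mapping.single
  have congr: "?s w 1 - ?s 0 (\<chi> w) \<in> Idl\<^bsub>?R\<^esub> ?G" if "w \<in> submonoid_span G" for w
    using that
  proof induction
    case zero
    then show ?case using I' by (simp add: \<chi>')
  next
    case (add g w)
    have "?s (g + w) 1 - ?s 0 (\<chi> (g + w)) =
        ?s w 1 * (?s g 1 - ?s 0 (\<chi> g)) + ?s 0 (\<chi> g) * (?s w 1 - ?s 0 (\<chi> w))"
      by (simp add: mult_single algebra_simps \<chi>')
    also have "\<dots> \<in> Idl\<^bsub>?R\<^esub> ?G"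
      using add GI by (intro I_add I_mult) auto
    finally show ?case .
  qed
  show "?K \<subseteq> Idl\<^bsub>?R\<^esub> ?G"
  proof
    fix f assume f: "f \<in> ?K"
    let ?l = "Poly_Mapping.lookup f" and ?k = "Poly_Mapping.keys f"
    have "f = (\<Sum>w\<in>?k. ?s w (?l w)) - ?s 0 (\<Sum>w\<in>?k. ?l w * \<chi> w)"
      using f by (simp add: poly_mapping_sum_singles monoid_eval_def)
    also have "?s 0 (\<Sum>w\<in>?k. ?l w * \<chi> w) = (\<Sum>w\<in>?k. ?s 0 (?l w * \<chi> w))"
    proof -
      have "?s 0 (sum F J) = (\<Sum>j\<in>J. ?s 0 (F j))" for F :: "'m \<Rightarrow> 'k" and J
        by (induction J rule: infinite_finite_induct) (simp_all add: single_add)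
      then show ?thesis .
    qed
    also have "(\<Sum>w\<in>?k. ?s w (?l w)) - (\<Sum>w\<in>?k. ?s 0 (?l w * \<chi> w)) =
        (\<Sum>w\<in>?k. ?s 0 (?l w) * (?s w 1 - ?s 0 (\<chi> w)))"
      by (simp add: sum_subtractf right_diff_distrib mult_single)
    also have "\<dots> \<in> Idl\<^bsub>?R\<^esub> ?G"
    proof -
      have *: "sum F J \<in> Idl\<^bsub>?R\<^esub> ?G" if "\<And>j. j \<in> J \<Longrightarrow> F j \<in> Idl\<^bsub>?R\<^esub> ?G"
        for F :: "'m \<Rightarrow> 'm \<Rightarrow>\<^sub>0 'k" and J
        using that I' by (induction J rule: infinite_finite_induct) (auto intro: I_add)
      then show ?thesis
        using f by (intro * I_mult congr) (auto simp: monoid_ring_def submonoid_span.zero)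
    qed
    finally show "f \<in> Idl\<^bsub>?R\<^esub> ?G" .
  qed
qed

end

section \<open>Polynomials and the Nullstellensatz\<close>

definition monomials :: "'v set \<Rightarrow> ('v \<Rightarrow>\<^sub>0 nat) set" where
  "monomials V = {\<mu>. Poly_Mapping.keys \<mu> \<subseteq> V}"

definition monomial_value :: "('v \<Rightarrow> 'k::comm_ring_1) \<Rightarrow> ('v \<Rightarrow>\<^sub>0 nat) \<Rightarrow> 'k" where
  "monomial_value \<alpha> \<mu> = (\<Prod>v\<in>Poly_Mapping.keys \<mu>. \<alpha> v ^ Poly_Mapping.lookup \<mu> v)"

lemma monomial_value_superset:
  assumes "finite A" and "Poly_Mapping.keys \<mu> \<subseteq> A"
  shows "monomial_value \<alpha> \<mu> = (\<Prod>v\<in>A. \<alpha> v ^ Poly_Mapping.lookup \<mu> v)"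
  unfolding monomial_value_def
  by (rule prod.mono_neutral_left) (use assms in \<open>auto simp: in_keys_iff\<close>)

lemma monoid_character_monomial_value: "monoid_character (monomial_value \<alpha>)"
  unfolding monoid_character_def
proof (intro conjI allI)
  fix \<mu> \<nu> :: "'a \<Rightarrow>\<^sub>0 nat"
  let ?A = "Poly_Mapping.keys \<mu> \<union> Poly_Mapping.keys \<nu>"
  have "monomial_value \<alpha> \<rho> = (\<Prod>v\<in>?A. \<alpha> v ^ Poly_Mapping.lookup \<rho> v)"
    if "\<rho> \<in> {\<mu>, \<nu>, \<mu> + \<nu>}" for \<rho>
    using that keys_add[of \<mu> \<nu>] by (intro monomial_value_superset) auto
  then show "monomial_value \<alpha> (\<mu> + \<nu>) = monomial_value \<alpha> \<mu> * monomial_value \<alpha> \<nu>"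
    by (simp add: lookup_add power_add prod.distrib)
qed (simp add: monomial_value_def)

lemma monomials_eq_span:
  "monomials V = submonoid_span ((\<lambda>v. Poly_Mapping.single v 1) ` V)"
proof (intro equalityI subsetI)
  fix \<mu> assume "\<mu> \<in> monomials V"
  have "(\<Sum>v\<in>A. Poly_Mapping.single v (k v)) \<in> submonoid_span ((\<lambda>v. Poly_Mapping.single v 1) ` V)"
    if "A \<subseteq> V" for A and k :: "'a \<Rightarrow> nat"
    using that
  proof (induction A rule: infinite_finite_induct)
    case (insert v A)
    have "Poly_Mapping.single v j \<in> submonoid_span ((\<lambda>v. Poly_Mapping.single v 1) ` V)" for j :: nat
    proof (induction j)
      case (Suc j)
      have "Poly_Mapping.single v (Suc j) = Poly_Mapping.single v 1 + Poly_Mapping.single v j"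
        by (simp add: single_add[symmetric])
      with Suc insert show ?case by (auto intro!: submonoid_span.add)
    qed (simp add: submonoid_span.zero)
    with insert show ?case by (simp add: submonoid_span_add)
  qed (simp_all add: submonoid_span.zero)
  from this[of "Poly_Mapping.keys \<mu>" "Poly_Mapping.lookup \<mu>"] \<open>\<mu> \<in> monomials V\<close>
  show "\<mu> \<in> submonoid_span ((\<lambda>v. Poly_Mapping.single v 1) ` V)"
    by (simp add: monomials_def poly_mapping_sum_singles)
next
  fix \<mu> assume "\<mu> \<in> submonoid_span ((\<lambda>v. Poly_Mapping.single v (1::nat)) ` V)"
  then show "\<mu> \<in> monomials V"
    by induction (use keys_add in \<open>fastforce simp: monomials_def\<close>)+
qed

abbreviation polynomials :: "'v set \<Rightarrow> (('v \<Rightarrow>\<^sub>0 nat) \<Rightarrow>\<^sub>0 'k::comm_ring_1) set" where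
  "polynomials V \<equiv> monoid_ring (monomials V)"

lemma subring_polynomials: "subring_set (polynomials V)"
  unfolding monomials_eq_span by (rule subring_span)

abbreviation point_eval :: "('v \<Rightarrow> 'k::comm_ring_1) \<Rightarrow> (('v \<Rightarrow>\<^sub>0 nat) \<Rightarrow>\<^sub>0 'k) \<Rightarrow> 'k" where
  "point_eval \<alpha> \<equiv> monoid_eval (monomial_value \<alpha>)"

abbreviation var :: "'v \<Rightarrow> (('v \<Rightarrow>\<^sub>0 nat) \<Rightarrow>\<^sub>0 'k::comm_ring_1)" where
  "var v \<equiv> Poly_Mapping.single (Poly_Mapping.single v 1) 1"

lemma point_eval_var [simp]: "point_eval \<alpha> (var v) = \<alpha> v"
  by (simp add: monomial_value_def)

lemma point_eval_cong:
  assumes "p \<in> polynomials V" and "\<And>v. v \<in> V \<Longrightarrow> \<alpha> v = \<beta> v"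
  shows "point_eval \<alpha> p = point_eval \<beta> p"
  using assms unfolding monoid_eval_def monomial_value_def monoid_ring_def monomials_def
  by (intro sum.cong refl arg_cong2[of _ _ _ _ "(*)"] prod.cong) (auto simp: subset_iff)

text \<open>
  A polynomial is a polynomial in one variable over the ring of polynomials in the others:
  \<open>\<nu>\<close> removes the variable \<open>x\<close> from a monomial.
\<close>

lemma polynomials_insert:
  assumes "p \<in> polynomials (insert x V)"
  shows "\<exists>q \<in> polys_over (polynomials V). poly q (var x) = p"
proof -
  interpret V: subring_set "polynomials V :: (('a \<Rightarrow>\<^sub>0 nat) \<Rightarrow>\<^sub>0 'b) set" by (rule subring_polynomials)
  interpret P: subring_set "polys_over (polynomials V :: (('a \<Rightarrow>\<^sub>0 nat) \<Rightarrow>\<^sub>0 'b) set)"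
    by (rule V.subring_polys_over)
  define \<nu> :: "('a \<Rightarrow>\<^sub>0 nat) \<Rightarrow> ('a \<Rightarrow>\<^sub>0 nat)"
    where "\<nu> = (\<lambda>\<mu>. \<mu> - Poly_Mapping.single x (Poly_Mapping.lookup \<mu> x))"
  define q where "q = (\<Sum>\<mu>\<in>Poly_Mapping.keys p.
    monom (Poly_Mapping.single (\<nu> \<mu>) (Poly_Mapping.lookup p \<mu>)) (Poly_Mapping.lookup \<mu> x))"
  have "\<nu> \<mu> \<in> monomials V" if "\<mu> \<in> monomials (insert x V)" for \<mu>
    using that by (auto simp: monomials_def \<nu>_def in_keys_iff lookup_minus lookup_single when_def
        subset_iff split: if_splits)
  then have "q \<in> polys_over (polynomials V)"
    unfolding q_def using assms
    by (intro P.sum_closed V.monom_polys_over single_monoid_ring) (auto simp: monoid_ring_def)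
  moreover have "poly q (var x) = p"
  proof -
    have var_power: "var x ^ k = Poly_Mapping.single (Poly_Mapping.single x k) (1::'b)" for k
      by (induction k) (simp_all add: mult_single single_add[symmetric])
    have "\<nu> \<mu> + Poly_Mapping.single x (Poly_Mapping.lookup \<mu> x) = \<mu>" for \<mu>
      by (rule poly_mapping_eqI) (simp add: \<nu>_def lookup_add lookup_minus lookup_single when_def)
    then have "poly q (var x) =
        (\<Sum>\<mu>\<in>Poly_Mapping.keys p. Poly_Mapping.single \<mu> (Poly_Mapping.lookup p \<mu>))"
      by (simp only: q_def poly_sum poly_monom var_power mult_single mult_1_right)
    then show ?thesis by (simp add: poly_mapping_sum_singles)
  qed
  ultimately show ?thesis by blast
qed

lemma poly_eq_sum_atMost:
  fixes p :: "'a::comm_ring_1 poly"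
  assumes "degree p \<le> N"
  shows "poly p y = (\<Sum>i\<le>N. coeff p i * y ^ i)"
  unfolding poly_altdef
  by (rule sum.mono_neutral_left) (use assms in \<open>auto simp: coeff_eq_0\<close>)

lemma point_eval_poly_var:
  assumes "q \<in> polys_over (polynomials V)" and "x \<notin> V"
  shows "point_eval (\<alpha>(x := \<xi>)) (poly q (var x)) = poly (map_poly (point_eval \<alpha>) q) \<xi>"
proof -
  note h = unital_hom_simps[OF unital_hom_monoid_eval[OF monoid_character_monomial_value]]
  have "point_eval (\<alpha>(x := \<xi>)) (poly q (var x)) =
      (\<Sum>i\<le>degree q. point_eval (\<alpha>(x := \<xi>)) (coeff q i) * \<xi> ^ i)"
    unfolding poly_altdef h point_eval_var by simp
  also have "\<dots> = (\<Sum>i\<le>degree q. point_eval \<alpha> (coeff q i) * \<xi> ^ i)"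
    using assms by (intro sum.cong refl arg_cong2[of _ _ _ _ "(*)"] point_eval_cong) (auto dest: polys_overD)
  also have "\<dots> = poly (map_poly (point_eval \<alpha>) q) \<xi>"
  proof -
    have "degree (map_poly (point_eval \<alpha>) q) \<le> degree q"
      by (intro degree_le) (simp add: coeff_map_poly coeff_eq_0)
    from poly_eq_sum_atMost[OF this, of \<xi>] show ?thesis
      by (simp add: coeff_map_poly)
  qed
  finally show ?thesis .
qed

text \<open>
  Induction on the set \<open>W\<close> of those variables whose coordinates have been chosen. For
  \<open>W = {}\<close> only constants are concerned, and \<open>P\<close> contains no constant except \<open>0\<close>. In the step
  the element \<open>r\<close> of \<open>extension_step\<close> is the new element to be avoided, which is why the
  statement is about an arbitrary \<open>b \<notin> P\<close> and not only about \<open>b = 1\<close>.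
\<close>

theorem nullstellensatz_avoiding:
  fixes P :: "(('v \<Rightarrow>\<^sub>0 nat) \<Rightarrow>\<^sub>0 'k::alg_closed_field) set"
  assumes P: "prime_in (polynomials V) P" and "finite W" and "W \<subseteq> V"
    and "b \<in> polynomials W" and "b \<notin> P"
  shows "\<exists>\<alpha>. (\<forall>p \<in> P \<inter> polynomials W. point_eval \<alpha> p = 0) \<and> point_eval \<alpha> b \<noteq> 0"
  using assms(2-)
proof (induction W arbitrary: b rule: finite_induct)
  case empty
  let ?c = "\<lambda>c. Poly_Mapping.single 0 c :: ('v \<Rightarrow>\<^sub>0 nat) \<Rightarrow>\<^sub>0 'k"
  have const: "p = ?c (Poly_Mapping.lookup p 0)" if "p \<in> polynomials {}"
    for p :: "('v \<Rightarrow>\<^sub>0 nat) \<Rightarrow>\<^sub>0 'k"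
    using that by (intro poly_mapping_eqI)
      (auto simp: monoid_ring_def monomials_def lookup_single when_def in_keys_iff)
  have "c = 0" if "?c c \<in> P" for c
  proof (rule ccontr)
    assume "c \<noteq> 0"
    have "?c (1 / c) * ?c c \<in> P"
      using P that by (simp add: prime_in_def monoid_ring_def monomials_def)
    with \<open>c \<noteq> 0\<close> P show False by (simp add: mult_single prime_in_def)
  qed
  then have "p = 0" if "p \<in> P \<inter> polynomials {}" for p
    using that const[of p] by (metis IntE single_zero)
  moreover have "point_eval (\<lambda>_. 0) b \<noteq> 0"
  proof -
    obtain c where b: "b = ?c c" using const[OF empty(2)] by blast
    have "c \<noteq> 0" using P empty(3) by (auto simp: b prime_in_def)
    then show ?thesis by (simp add: b monomial_value_def)
  qed
  ultimately show ?case
    by (metis monoid_eval_zero)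
next
  case (insert x W)
  have "monomials W \<subseteq> monomials V"
    using insert.prems by (auto simp: monomials_def)
  then have sub: "polynomials W \<subseteq> (polynomials V :: (('v \<Rightarrow>\<^sub>0 nat) \<Rightarrow>\<^sub>0 'k) set)"
    by (auto simp: monoid_ring_def)
  have var: "var x \<in> (polynomials V :: (('v \<Rightarrow>\<^sub>0 nat) \<Rightarrow>\<^sub>0 'k) set)"
    using insert.prems by (auto simp: monoid_ring_def monomials_def)
  interpret prime_over_subring "polynomials V" "polynomials W" P "var x"
    by (rule prime_over_subring.intro[OF subring_polynomials subring_polynomials
          prime_over_subring_axioms.intro[OF sub P var]])
  obtain bh where bh: "bh \<in> polys_over (polynomials W)" "poly bh (var x) = b"
    using polynomials_insert[OF insert.prems(2)] by (rule bexE)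
  have "poly bh (var x) \<notin> P" using insert.prems bh(2) by simp
  from extension_step[OF bh(1) this]
  obtain r where r: "r \<in> polynomials W - P"
    and ext: "\<forall>\<phi> :: _ \<Rightarrow> 'k.
      unital_hom \<phi> \<and> (\<forall>p \<in> P \<inter> polynomials W. \<phi> p = 0) \<and> \<phi> r \<noteq> 0 \<longrightarrow>
      (\<exists>\<xi>. (\<forall>q \<in> polys_over (polynomials W). poly q (var x) \<in> P \<longrightarrow> poly (map_poly \<phi> q) \<xi> = 0) \<and>
           poly (map_poly \<phi> bh) \<xi> \<noteq> 0)"
    by (rule bexE)
  obtain \<alpha> where \<alpha>: "\<forall>p \<in> P \<inter> polynomials W. point_eval \<alpha> p = 0" "point_eval \<alpha> r \<noteq> 0"
    using insert.IH[of r] insert.prems r by blast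
  obtain \<xi> where \<xi>: "\<And>q. q \<in> polys_over (polynomials W) \<Longrightarrow> poly q (var x) \<in> P \<Longrightarrow>
        poly (map_poly (point_eval \<alpha>) q) \<xi> = 0"
      and \<xi>b: "poly (map_poly (point_eval \<alpha>) bh) \<xi> \<noteq> 0"
    using ext[rule_format, of "point_eval \<alpha>"] \<alpha>
      unital_hom_monoid_eval[OF monoid_character_monomial_value, of \<alpha>] by blast
  show ?case
  proof (intro exI conjI ballI)
    show "point_eval (\<alpha>(x := \<xi>)) b \<noteq> 0"
      using \<xi>b point_eval_poly_var[OF bh(1) insert.hyps(2), of \<alpha> \<xi>] unfolding bh(2) by simp
    fix p assume p: "p \<in> P \<inter> polynomials (insert x W)"
    then have "p \<in> polynomials (insert x W)" by (rule IntD2)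
    from polynomials_insert[OF this]
    obtain q where q: "q \<in> polys_over (polynomials W)" "poly q (var x) = p"
      by (rule bexE)
    have "poly (map_poly (point_eval \<alpha>) q) \<xi> = 0"
      using p by (intro \<xi> q(1)) (simp add: q(2) del: One_nat_def)
    then show "point_eval (\<alpha>(x := \<xi>)) p = 0"
      using point_eval_poly_var[OF q(1) insert.hyps(2), of \<alpha> \<xi>] unfolding q(2) by simp
  qed
qed

section \<open>Splitting off the first column of a tableau\<close>

lemma rows_zero: "rows 0 = []"
  and rows_add: "rows (S + T) = star_rows (rows S) (rows T)"
  by (simp_all add: zero_ssyt.rep_eq plus_ssyt.rep_eq)

lemma SSYT_iff_row:
  "T \<in> SSYT m n \<longleftrightarrow> length (rows T) \<le> n \<and> (\<forall>i. set (row (rows T) i) \<subseteq> {1..m})"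
proof -
  have "(\<forall>r\<in>set R. set r \<subseteq> A) \<longleftrightarrow> (\<forall>i. set (row R i) \<subseteq> A)" for R and A :: "nat set"
    by (auto simp: row_def all_set_conv_all_nth)
  then show ?thesis by (simp add: SSYT_def)
qed

lemma zero_SSYT: "0 \<in> SSYT m n"
  by (simp add: SSYT_def rows_zero)

lemma add_SSYT: "S \<in> SSYT m n \<Longrightarrow> T \<in> SSYT m n \<Longrightarrow> S + T \<in> SSYT m n"
  by (simp add: SSYT_iff_row rows_add row_star_rows)

lemma wt_zero: "wt 0 i j = 0"
  by (simp add: wt_def rows_zero row_def)

lemma wt_add: "wt (S + T) i j = wt S i j + wt T i j"
  by (simp add: wt_def rows_add row_star_rows flip: count_mset)

definition first_column :: "nat list list \<Rightarrow> nat list list" where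
  "first_column R = map (\<lambda>r. [hd r]) R"

text \<open>
  Removing the first column of a tableau makes the rows of length 1 empty. These rows are
  the last ones, and they must be dropped from the list: row lists have no empty entries.
\<close>

definition later_columns :: "nat list list \<Rightarrow> nat list list" where
  "later_columns R = map (\<lambda>i. tl (row R i)) [0..<LEAST i. length (row R i) \<le> 1]"

lemma row_first_column:
  "row (first_column R) i = (if i < length R then [hd (row R i)] else [])"
  by (simp add: first_column_def row_def)

lemma semistandard_row_antimono:
  assumes "semistandard R" and "i \<le> j"
  shows "length (row R j) \<le> length (row R i)"
proof (rule lift_Suc_antimono_le[OF _ \<open>i \<le> j\<close>])
  show "length (row R (Suc i)) \<le> length (row R i)" for i
    using assms(1) unfolding semistandard_iff_row column_strict_def by blast
qed

lemma semistandard_first_column: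
  assumes "semistandard R"
  shows "semistandard (first_column R)"
  unfolding semistandard_iff_row
proof (intro allI conjI)
  note R = assms[unfolded semistandard_iff_row, rule_format]
  fix i
  show "i < length (first_column R) \<longrightarrow> row (first_column R) i \<noteq> []"
    by (simp add: row_first_column) (simp add: first_column_def)
  show "sorted (row (first_column R) i)" by (simp add: row_first_column)
  show "\<forall>x\<in>set (row (first_column R) i). 0 < x"
    using R[of i] by (auto simp: row_first_column)
  show "column_strict (row (first_column R) i) (row (first_column R) (Suc i))"
    using R[of i] R[of "Suc i"]
    by (auto simp: row_first_column column_strict_def hd_conv_nth)
qed

context
  fixes R :: "nat list list"
  assumes R: "semistandard R"
begin

lemma long_rows_iff: "i < (LEAST i. length (row R i) \<le> 1) \<longleftrightarrow> 1 < length (row R i)"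
proof -
  let ?k = "LEAST i. length (row R i) \<le> 1"
  have "length (row R ?k) \<le> 1"
    by (rule LeastI[of _ "length R"]) (simp add: row_def)
  then have "length (row R i) \<le> 1" if "?k \<le> i"
    using semistandard_row_antimono[OF R that] by linarith
  then show ?thesis
    using not_less_Least[of i "\<lambda>i. length (row R i) \<le> 1"] by (meson not_le)
qed

lemma row_later_columns: "row (later_columns R) i = tl (row R i)"
proof (cases "i < (LEAST i. length (row R i) \<le> 1)")
  case True
  then show ?thesis unfolding row_def[of "later_columns R"] by (simp add: later_columns_def)
next
  case False
  then have "tl (row R i) = []" using long_rows_iff[of i] by (cases "row R i") auto
  with False show ?thesis unfolding row_def[of "later_columns R"] by (simp add: later_columns_def)
qed

lemma length_later_columns: "length (later_columns R) \<le> length R"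
proof -
  have "(LEAST i. length (row R i) \<le> 1) \<le> length R"
    by (rule Least_le) (simp add: row_def)
  then show ?thesis by (simp add: later_columns_def)
qed

lemma semistandard_later_columns: "semistandard (later_columns R)"
  unfolding semistandard_iff_row row_later_columns
proof (intro allI conjI)
  fix i
  note R' = R[unfolded semistandard_iff_row, rule_format]
  show "i < length (later_columns R) \<longrightarrow> tl (row R i) \<noteq> []"
    using long_rows_iff[of i] by (cases "row R i") (auto simp: later_columns_def)
  show "sorted (tl (row R i))" using R'[of i] by (simp add: sorted_tl)
  show "\<forall>x\<in>set (tl (row R i)). 0 < x"
    using R'[of i] by (cases "row R i") auto
  show "column_strict (tl (row R i)) (tl (row R (Suc i)))"
    using R'[of i] by (auto simp: column_strict_def nth_tl)
qed

lemma star_first_column_later_columns: "star_rows (first_column R) (later_columns R) = R"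
proof (rule rows_eqI)
  show "length (star_rows (first_column R) (later_columns R)) = length R"
    using length_later_columns by (simp add: first_column_def)
  fix i
  show "row (star_rows (first_column R) (later_columns R)) i = row R i"
  proof (cases "i < length R")
    case True
    then have "row R i \<noteq> []" and "sorted (row R i)"
      using R[unfolded semistandard_iff_row, rule_format, of i] by auto
    with True show ?thesis
      unfolding row_star_rows row_first_column row_later_columns
      by (simp add: sorted_sort_id del: sort_key_simps)
  next
    case False
    then have "row R i = []" by (simp add: row_def)
    with False show ?thesis by (simp add: row_star_rows row_first_column row_later_columns)
  qed
qed

end

text \<open>
  Induction on the number of columns. The product of the first column with the rest restores
  the tableau, as sorting a row brings its smallest entry back to the front.
\<close>

lemma SSYT_eq_span_one_column: "SSYT m n = submonoid_span (one_column n m)"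
proof (intro equalityI subsetI)
  fix T assume "T \<in> submonoid_span (one_column n m)"
  then show "T \<in> SSYT m n"
    by induction (auto simp: one_column_def zero_SSYT add_SSYT)
next
  fix T assume "T \<in> SSYT m n"
  then show "T \<in> submonoid_span (one_column n m)"
  proof (induction "length (row (rows T) 0)" arbitrary: T)
    case 0
    have "semistandard (rows T)" using rows[of T] by simp
    then have "rows T = []"
      using 0(1) unfolding semistandard_iff_row by (metis length_0_conv length_greater_0_conv)
    then have "T = 0" by (simp add: rows_zero flip: rows_inject)
    then show ?case by (simp add: submonoid_span.zero)
  next
    case (Suc l)
    define R where "R = rows T"
    have R: "semistandard R" using rows[of T] by (simp add: R_def)
    define C where "C = Abs_ssyt (first_column R)"
    define T' where "T' = Abs_ssyt (later_columns R)"
    have rC: "rows C = first_column R" and rT': "rows T' = later_columns R"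
      using R by (simp_all add: C_def T'_def Abs_ssyt_inverse semistandard_first_column
          semistandard_later_columns)
    have T: "T = C + T'"
      using star_first_column_later_columns[OF R]
      by (simp add: rows_add rC rT' R_def flip: rows_inject)
    have len: "length (row R 0) = Suc l" using Suc.hyps by (simp add: R_def)
    then have "0 < length R" by (auto simp: row_def split: if_splits)
    have RT: "length R \<le> n" "\<And>i. set (row R i) \<subseteq> {1..m}"
      using Suc.prems by (simp_all add: SSYT_iff_row R_def)
    have "row R i \<noteq> []" if "i < length R" for i
      using R that by (simp add: semistandard_iff_row)
    then have "hd (row R i) \<in> {1..m}" if "i < length R" for i
      using RT(2)[of i] that hd_in_set by blast
    then have "C \<in> one_column n m"
      using RT \<open>0 < length R\<close>
      by (auto simp: one_column_def SSYT_iff_row rC row_first_column) (simp add: first_column_def)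
    moreover have "set (tl (row R i)) \<subseteq> {1..m}" for i
      using RT(2)[of i] by (cases "row R i") auto
    then have "T' \<in> SSYT m n"
      unfolding SSYT_iff_row rT' row_later_columns[OF R]
      using RT(1) length_later_columns[OF R] by (auto intro: le_trans)
    moreover have "l = length (row (rows T') 0)"
      by (simp add: rT' row_later_columns[OF R] len)
    ultimately show ?case
      unfolding T using Suc.hyps(1) by (blast intro: submonoid_span.add)
  qed
qed

section \<open>The two spectra\<close>

lemma monoid_character_ev: "monoid_character (ev n m \<alpha>)"
  by (simp add: monoid_character_def ev_def wt_zero wt_add power_add prod.distrib)

lemma tableaux_algebra_eq: "tableaux_algebra n m = ring_on (monoid_ring (SSYT m n))"
  by (simp add: tableaux_algebra_def monoid_ring_def)

abbreviation grid :: "nat \<Rightarrow> nat \<Rightarrow> (nat \<times> nat) set" where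
  "grid n m \<equiv> {1..n} \<times> {1..m}"

lemma polynomial_algebra_eq: "polynomial_algebra n m = ring_on (polynomials (grid n m))"
  unfolding polynomial_algebra_def monoid_ring_def monomials_def
  by (rule arg_cong[of _ _ ring_on]) auto

lemma tableaux_ideal_Psi:
  "tableaux_ideal n m (Psi n m \<alpha>) = {f \<in> monoid_ring (SSYT m n). monoid_eval (ev n m \<alpha>) f = 0}"
proof -
  have "{Poly_Mapping.single T 1 - Poly_Mapping.single 0 (Psi n m \<alpha> T) |T. T \<in> one_column n m} =
      {Poly_Mapping.single T 1 - Poly_Mapping.single 0 (ev n m \<alpha> T) |T. T \<in> one_column n m}"
    by (auto simp: Psi_def)
  then show ?thesis
    unfolding tableaux_ideal_def tableaux_algebra_eq SSYT_eq_span_one_column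
    by (simp add: genideal_eq_kernel[OF monoid_character_ev])
qed

lemma polynomial_ideal_eq:
  "polynomial_ideal n m \<alpha> = {p \<in> polynomials (grid n m). point_eval \<alpha> p = 0}"
proof -
  have "{Poly_Mapping.single (Poly_Mapping.single (i, j) 1) 1 - Poly_Mapping.single 0 (\<alpha> (i, j)) |
        i j. i \<in> {1..n} \<and> j \<in> {1..m}} =
      {Poly_Mapping.single g 1 - Poly_Mapping.single 0 (monomial_value \<alpha> g) |
        g. g \<in> (\<lambda>v. Poly_Mapping.single v 1) ` grid n m}"
    by (force simp: monomial_value_def)
  then show ?thesis
    unfolding polynomial_ideal_def polynomial_algebra_eq monomials_eq_span
    by (simp only: genideal_eq_kernel[OF monoid_character_monomial_value])
qed

lemma tableaux_ideal_Psi_maximal: "tableaux_ideal n m (Psi n m \<alpha>) \<in> max_spec (tableaux_algebra n m)"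
  unfolding max_spec_def mem_Collect_eq tableaux_ideal_Psi tableaux_algebra_eq SSYT_eq_span_one_column
  by (rule maximalideal_monoid_eval[OF monoid_character_ev])

lemma polynomial_ideal_maximal: "polynomial_ideal n m \<alpha> \<in> max_spec (polynomial_algebra n m)"
  unfolding max_spec_def mem_Collect_eq polynomial_ideal_eq polynomial_algebra_eq monomials_eq_span
  by (rule maximalideal_monoid_eval[OF monoid_character_monomial_value])

lemma Psi_in_tableaux_points: "Psi n m \<alpha> \<in> tableaux_points n m"
proof -
  have "Psi n m \<alpha> A * Psi n m \<alpha> B = Psi n m \<alpha> C * Psi n m \<alpha> E"
    if "A \<in> one_column n m" "B \<in> one_column n m" "C \<in> one_column n m" "E \<in> one_column n m"
      "A + B = C + E" for A B C E
    using arg_cong[OF that(5), of "ev n m \<alpha>"] that(1-4) monoid_character_ev[of n m \<alpha>]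
    by (simp add: monoid_character_def Psi_def)
  moreover have "Psi n m \<alpha> \<in> one_column n m \<rightarrow>\<^sub>E UNIV"
    by (simp add: Psi_def)
  ultimately show ?thesis unfolding tableaux_points_def by blast
qed

text \<open>
  A maximal ideal is prime and avoids \<open>1\<close>, so by the Nullstellensatz it has a zero \<open>\<alpha>\<close>. It is
  contained in the ideal of \<open>\<alpha>\<close>, and equal to it by maximality.
\<close>

lemma max_spec_polynomial_algebra:
  "max_spec (polynomial_algebra n m) =
     (polynomial_ideal n m :: (nat \<times> nat \<Rightarrow> 'k::alg_closed_field) \<Rightarrow> _) ` polynomial_points n m"
proof (intro equalityI subsetI)
  fix M :: "((nat \<times> nat \<Rightarrow>\<^sub>0 nat) \<Rightarrow>\<^sub>0 'k) set"
  assume "M \<in> max_spec (polynomial_algebra n m)"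
  then have M: "maximalideal M (ring_on (polynomials (grid n m)))"
    by (simp add: max_spec_def polynomial_algebra_eq)
  interpret S: subring_set "polynomials (grid n m) :: ((nat \<times> nat \<Rightarrow>\<^sub>0 nat) \<Rightarrow>\<^sub>0 'k) set"
    by (rule subring_polynomials)
  have prime: "prime_in (polynomials (grid n m)) M" by (rule S.maximal_imp_prime_in[OF M])
  then have "1 \<notin> M" and sub: "M \<subseteq> polynomials (grid n m)" by (auto simp: prime_in_def)
  then obtain \<beta> where \<beta>: "\<And>p. p \<in> M \<Longrightarrow> point_eval \<beta> p = 0"
    using nullstellensatz_avoiding[OF prime _ order_refl S.one_closed] by auto
  define \<alpha> where "\<alpha> = restrict \<beta> (grid n m)"
  have "M \<subseteq> polynomial_ideal n m \<alpha>"
  proof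
    fix p assume p: "p \<in> M"
    have "point_eval \<alpha> p = point_eval \<beta> p"
      using p sub by (intro point_eval_cong[of p "grid n m"]) (auto simp: \<alpha>_def)
    with p sub \<beta> show "p \<in> polynomial_ideal n m \<alpha>" by (auto simp: polynomial_ideal_eq)
  qed
  moreover have N: "maximalideal (polynomial_ideal n m \<alpha>) (ring_on (polynomials (grid n m)))"
    using polynomial_ideal_maximal[of n m \<alpha>] by (simp add: max_spec_def polynomial_algebra_eq)
  ultimately have "polynomial_ideal n m \<alpha> = M"
    using maximalideal.I_maximal[OF M, of "polynomial_ideal n m \<alpha>"] maximalideal.I_notcarr[OF N]
      maximalideal.axioms(1)[OF N] by (auto simp: polynomial_ideal_eq)
  then show "M \<in> polynomial_ideal n m ` polynomial_points n m"
    by (auto simp: polynomial_points_def \<alpha>_def)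
qed (auto intro: polynomial_ideal_maximal)

text \<open>
  The coordinate \<open>\<alpha> v\<close> is determined by the ideal, which contains \<open>x\<^sub>v - \<alpha> v\<close>.
\<close>

lemma inj_on_polynomial_ideal:
  "inj_on (polynomial_ideal n m :: (nat \<times> nat \<Rightarrow> 'k::field) \<Rightarrow> _) (polynomial_points n m)"
proof (rule inj_onI)
  fix \<alpha> \<beta> :: "nat \<times> nat \<Rightarrow> 'k"
  assume pts: "\<alpha> \<in> polynomial_points n m" "\<beta> \<in> polynomial_points n m"
    and eq: "polynomial_ideal n m \<alpha> = polynomial_ideal n m \<beta>"
  interpret S: subring_set "polynomials (grid n m) :: ((nat \<times> nat \<Rightarrow>\<^sub>0 nat) \<Rightarrow>\<^sub>0 'k) set"
    by (rule subring_polynomials)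
  have "\<alpha> v = \<beta> v" if v: "v \<in> grid n m" for v
  proof -
    let ?p = "var v - Poly_Mapping.single 0 (\<alpha> v)"
    have ev: "point_eval \<gamma> ?p = \<gamma> v - \<alpha> v" for \<gamma>
      using unital_hom_simps(5)[OF unital_hom_monoid_eval[OF monoid_character_monomial_value[of \<gamma>]]]
      by (simp add: monomial_value_def)
    have "?p \<in> polynomials (grid n m)"
      using v by (intro S.diff_closed single_monoid_ring) (auto simp: monomials_def)
    then have "?p \<in> polynomial_ideal n m \<alpha>" by (simp add: polynomial_ideal_eq ev del: monoid_eval_single One_nat_def)
    then have "point_eval \<beta> ?p = 0" unfolding eq by (simp add: polynomial_ideal_eq)
    then show ?thesis by (simp only: ev) simp
  qed
  with pts show "\<alpha> = \<beta>" unfolding polynomial_points_def by (intro PiE_ext) auto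
qed

section \<open>The morphism from tableaux to polynomials\<close>

definition tableau_monomial :: "nat \<Rightarrow> nat \<Rightarrow> ssyt \<Rightarrow> (nat \<times> nat \<Rightarrow>\<^sub>0 nat)" where
  "tableau_monomial n m T = (\<Sum>v\<in>grid n m. Poly_Mapping.single v (wt T (fst v) (snd v)))"

definition Omega :: "nat \<Rightarrow> nat \<Rightarrow> (ssyt \<Rightarrow>\<^sub>0 'k::field) \<Rightarrow> ((nat \<times> nat \<Rightarrow>\<^sub>0 nat) \<Rightarrow>\<^sub>0 'k)" where
  "Omega n m f =
     (\<Sum>T\<in>Poly_Mapping.keys f. Poly_Mapping.single (tableau_monomial n m T) (Poly_Mapping.lookup f T))"

lemma lookup_tableau_monomial:
  "Poly_Mapping.lookup (tableau_monomial n m T) v = (if v \<in> grid n m then wt T (fst v) (snd v) else 0)"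
  by (simp add: tableau_monomial_def lookup_sum lookup_single when_def)

lemma tableau_monomial_in_monomials: "tableau_monomial n m T \<in> monomials (grid n m)"
  by (auto simp: monomials_def in_keys_iff lookup_tableau_monomial split: if_splits)

lemma monomial_value_tableau_monomial: "monomial_value \<alpha> (tableau_monomial n m T) = ev n m \<alpha> T"
proof -
  have "monomial_value \<alpha> (tableau_monomial n m T) =
      (\<Prod>v\<in>grid n m. \<alpha> v ^ Poly_Mapping.lookup (tableau_monomial n m T) v)"
    using tableau_monomial_in_monomials[of n m T]
    by (intro monomial_value_superset) (auto simp: monomials_def)
  also have "\<dots> = (\<Prod>v\<in>grid n m. \<alpha> v ^ wt T (fst v) (snd v))"
    by (intro prod.cong refl) (simp add: lookup_tableau_monomial)
  also have "\<dots> = ev n m \<alpha> T"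
    by (simp add: ev_def prod.cartesian_product case_prod_beta)
  finally show ?thesis .
qed

lemma Omega_in_polynomials: "Omega n m f \<in> polynomials (grid n m)"
  unfolding Omega_def
  by (intro subring_set.sum_closed[OF subring_polynomials] single_monoid_ring
      tableau_monomial_in_monomials)

lemma point_eval_Omega: "point_eval \<alpha> (Omega n m f) = monoid_eval (ev n m \<alpha>) f"
  by (simp add: Omega_def monoid_eval_sum monomial_value_tableau_monomial) (simp add: monoid_eval_def)

section \<open>Open sets\<close>

text \<open>
  The common formula behind \<open>Theta\<close> and \<open>Xi\<close>, without a restriction on the domain. It is the
  preimage of \<open>U\<close> under \<open>N\<^sub>\<alpha> \<mapsto> M\<^bsub>\<Psi>(\<alpha>)\<^esub>\<close>.
\<close>

definition preimage_spec :: "nat \<Rightarrow> nat \<Rightarrow> (ssyt \<Rightarrow>\<^sub>0 'k::field) set set \<Rightarrow>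
    ((nat \<times> nat \<Rightarrow>\<^sub>0 nat) \<Rightarrow>\<^sub>0 'k) set set" where
  "preimage_spec n m U =
     polynomial_ideal n m ` {\<alpha> \<in> polynomial_points n m. tableaux_ideal n m (Psi n m \<alpha>) \<in> U}"

lemma Theta_eq: "U \<in> opens (tableaux_algebra n m) \<Longrightarrow> Theta n m U = preimage_spec n m U"
  by (auto simp: Theta_def preimage_spec_def polynomial_ideal_maximal Psi_in_tableaux_points)

lemma Xi_eq: "D \<in> basic_opens (tableaux_algebra n m) \<Longrightarrow> Xi n m D = preimage_spec n m D"
  by (auto simp: Xi_def preimage_spec_def Psi_in_tableaux_points)

text \<open>
  The inclusion from right to left is where the Nullstellensatz enters: a maximal ideal that does
  not contain \<open>\<Omega> f\<close> must be the ideal of a point.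
\<close>

lemma preimage_spec_basic_open:
  fixes f :: "ssyt \<Rightarrow>\<^sub>0 'k::alg_closed_field"
  assumes "f \<in> carrier (tableaux_algebra n m)"
  shows "preimage_spec n m (basic_open (tableaux_algebra n m) f) =
         basic_open (polynomial_algebra n m) (Omega n m f)"
proof -
  have "tableaux_ideal n m (Psi n m \<alpha>) \<in> basic_open (tableaux_algebra n m) f \<longleftrightarrow>
      Omega n m f \<notin> polynomial_ideal n m \<alpha>" for \<alpha> :: "nat \<times> nat \<Rightarrow> 'k"
  proof -
    have "f \<in> tableaux_ideal n m (Psi n m \<alpha>) \<longleftrightarrow> Omega n m f \<in> polynomial_ideal n m \<alpha>"
      using assms by (simp add: tableaux_ideal_Psi polynomial_ideal_eq tableaux_algebra_eq
          Omega_in_polynomials point_eval_Omega del: One_nat_def)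
    then show ?thesis by (simp add: basic_open_def tableaux_ideal_Psi_maximal)
  qed
  then show ?thesis
    by (auto simp: preimage_spec_def basic_open_def max_spec_polynomial_algebra)
qed

text \<open>
  Preimages commute with unions and intersections, so it is enough to treat the basic open
  sets. For intersections this uses that a point is determined by its ideal.
\<close>

lemma openin_preimage_spec:
  fixes U :: "(ssyt \<Rightarrow>\<^sub>0 'k::alg_closed_field) set set"
  assumes "openin (zariski (tableaux_algebra n m)) U"
  shows "openin (zariski (polynomial_algebra n m)) (preimage_spec n m U)"
  using assms unfolding zariski_def openin_topology_generated_by_iff[of _ U]
proof induction
  case Empty
  then show ?case by (simp add: preimage_spec_def)
next
  case (Int U V)
  have "preimage_spec n m (U \<inter> V) = preimage_spec n m U \<inter> preimage_spec n m V"
    using inj_on_polynomial_ideal unfolding preimage_spec_def inj_on_def by blast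
  with Int show ?case by auto
next
  case (UN K)
  have "preimage_spec n m (\<Union>K) = (\<Union>U\<in>K. preimage_spec n m U)"
    by (auto simp: preimage_spec_def)
  with UN show ?case by auto
next
  case (Basis D)
  then obtain f where f: "f \<in> carrier (tableaux_algebra n m)" "D = basic_open (tableaux_algebra n m) f"
    by (auto simp: basic_opens_def)
  have "Omega n m f \<in> carrier (polynomial_algebra n m)"
    by (simp add: polynomial_algebra_eq Omega_in_polynomials del: One_nat_def)
  with f show ?case
    by (auto simp: preimage_spec_basic_open basic_opens_def intro!: topology_generated_by_Basis)
qed

theorem theorem3p19:
  fixes n m :: nat
  assumes "0 < n" and "n \<le> m"
  shows "(Theta n m :: (ssyt \<Rightarrow>\<^sub>0 'k::{alg_closed_field,field_char_0}) set set \<Rightarrow> _)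
           \<in> opens (tableaux_algebra n m) \<rightarrow> opens (polynomial_algebra n m) \<and>
         (\<forall>f \<in> carrier (tableaux_algebra n m :: (ssyt \<Rightarrow>\<^sub>0 'k) ring).
            Theta n m (basic_open (tableaux_algebra n m) f) =
            Xi n m (basic_open (tableaux_algebra n m) f))"
proof (intro conjI funcsetI ballI)
  fix U :: "(ssyt \<Rightarrow>\<^sub>0 'k) set set"
  assume U: "U \<in> opens (tableaux_algebra n m)"
  then show "Theta n m U \<in> opens (polynomial_algebra n m)"
    unfolding Theta_eq[OF U] by (simp add: opens_def openin_preimage_spec)
next
  fix f :: "ssyt \<Rightarrow>\<^sub>0 'k"
  assume "f \<in> carrier (tableaux_algebra n m)"
  then have D: "basic_open (tableaux_algebra n m) f \<in> basic_opens (tableaux_algebra n m)"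
    by (simp add: basic_opens_def)
  then have "basic_open (tableaux_algebra n m) f \<in> opens (tableaux_algebra n m)"
    by (simp add: opens_def zariski_def topology_generated_by_Basis)
  then show "Theta n m (basic_open (tableaux_algebra n m) f) = Xi n m (basic_open (tableaux_algebra n m) f)"
    by (simp only: Theta_eq Xi_eq[OF D])
qed

end
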